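(* (a) $\mathfrak{b}(\mathrm{NWD})=\mathrm{add}(\mathcal{M})$. (b) $\mathfrak{p}\leq\mathfrak{b}(\mathrm{NULL})\leq\mathrm{add}(\mathcal{M})$. (c) $\mathfrak{b}(\mathrm{CTBL})=\aleph_1$.
   Context: An ideal on a set $X$ is a family $\mathcal{I}\subseteq\mathcal{P}(X)$ closed under finite unions and subsets, containing all finite subsets of $X$, and with $X\notin\mathcal{I}$. A $\sigma$-ideal on $X$ is an ideal on $X$ closed under countable unions. For an ideal $\mathcal{I}$ on a countable set $X$ and $f,g\in\omega^X$ write $f\leq_{\mathcal{I}}g$ if $\{x\in X: f(x)>g(x)\}\in\mathcal{I}$, let $\mathcal{D}_{\mathcal{I}}=\{f\in\omega^X: f^{-1}[\{n\}]\in\mathcal{I}\text{ for every }n\in\omega\}$, and let $\mathfrak{b}(\mathcal{I})$ be the least cardinality of a family $\mathcal{F}\subseteq\mathcal{D}_{\mathcal{I}}$ such that there is no $g\in\mathcal{D}_{\mathcal{I}}$ with $g\leq_{\mathcal{I}}f$ for all $f\in\mathcal{F}$. Equivalently (a known characterization), $\mathfrak{b}(\mathcal{I})$ is the least cardinality of a family $\mathcal{E}$ of sequences $\langle E_n:n\in\omega\rangle$ of pairwise disjoint members of $\mathcal{I}$ such that for every sequence $\langle A_n:n\in\omega\rangle$ of pairwise disjoint members of $\mathcal{I}$ with $\bigcup_n A_n=X$ there is $\langle E_n\rangle\in\mathcal{E}$ with $\bigcup_{n\in\omega}\left(A_n\cap\bigcup_{i\leq n}E_i\right)\notin\mathcal{I}$.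 $\mathcal{M}$ and $\mathcal{N}$ are the $\sigma$-ideals of meager and of null (with respect to the standard product measure) subsets of $2^\omega$; $\sigma\overline{\mathcal{N}}$ is the $\sigma$-ideal of sets covered by countably many compact null subsets of $2^\omega$; $[2^\omega]^{\leq\omega}$ is the $\sigma$-ideal of countable subsets of $2^\omega$. Fix a countable dense set $D\subseteq 2^\omega$. For a $\sigma$-ideal $I$ on $2^\omega$ let $\mathcal{J}_I=\{A\subseteq D:\mathrm{cl}_{2^\omega}(A)\in I\}$, an ideal on $D$ (up to isomorphism of ideals it does not depend on the choice of $D$). Put $\mathrm{NWD}=\mathcal{J}_{\mathcal{M}}$, $\mathrm{NULL}=\mathcal{J}_{\sigma\overline{\mathcal{N}}}$, $\mathrm{CTBL}=\mathcal{J}_{[2^\omega]^{\leq\omega}}$. $\mathrm{add}(\mathcal{M})=\min\{|\mathcal{A}|:\mathcal{A}\subseteq\mathcal{M},\ \bigcup\mathcal{A}\notin\mathcal{M}\}$. $\mathfrak{p}$ is the pseudointersection number: the least size of a family $\mathcal{A}\subseteq[\omega]^\omega$ such that every finite subfamily of $\mathcal{A}$ has infinite intersection but there is no infinite $S\subseteq\omega$ with $S\setminus A$ finite for all $A\in\mathcal{A}$. *)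

theory Defs
  imports "HOL-Probability.Probability"
begin

unbundle cardinal_syntax

subsection \<open>Least cardinalities\<close>

text \<open>Cardinal numbers are represented by cardinal orders and compared by \<open>=o\<close>, \<open>\<le>o\<close>, \<open><o\<close>,
  which may relate cardinal orders over different types.  A collection \<open>\<C>\<close> of sets that is empty
  has no least cardinality, and then the value of \<open>least_card \<C>\<close> is meaningless.\<close>

definition least_card :: "'a set set \<Rightarrow> 'a rel" where
  "least_card \<C> = |SOME A. A \<in> \<C> \<and> (\<forall>B\<in>\<C>. |A| \<le>o |B| )|"

lemma least_card:
  assumes "\<C> \<noteq> {}"
  shows least_card_attained: "\<exists>A\<in>\<C>. least_card \<C> = |A|"
    and least_card_le: "\<forall>B\<in>\<C>. least_card \<C> \<le>o |B|"
proof -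
  have "\<exists>r\<in>card_of ` \<C>. \<forall>r'\<in>card_of ` \<C>. r \<le>o r'"
    using assms by (intro exists_minim_Card_order) (auto simp: card_of_Card_order)
  then have "\<exists>A. A \<in> \<C> \<and> (\<forall>B\<in>\<C>. |A| \<le>o |B| )"
    by auto
  from someI_ex[OF this] show "\<exists>A\<in>\<C>. least_card \<C> = |A|" "\<forall>B\<in>\<C>. least_card \<C> \<le>o |B|"
    unfolding least_card_def by auto
qed

subsection \<open>The cardinals \<open>\<bb>(\<I>)\<close>, \<open>add(\<I>)\<close> and \<open>\<pp>\<close>\<close>

definition ideal_le :: "'a set \<Rightarrow> 'a set set \<Rightarrow> ('a \<Rightarrow> nat) \<Rightarrow> ('a \<Rightarrow> nat) \<Rightarrow> bool" where
  "ideal_le X \<I> f g \<longleftrightarrow> {x \<in> X. f x > g x} \<in> \<I>"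

text \<open>The extensional function space \<open>X \<rightarrow>\<^sub>E UNIV\<close> makes each function on \<open>X\<close> be represented
  exactly once.\<close>

definition ideal_to_one :: "'a set \<Rightarrow> 'a set set \<Rightarrow> ('a \<Rightarrow> nat) set" where
  "ideal_to_one X \<I> = {f \<in> X \<rightarrow>\<^sub>E UNIV. \<forall>n. {x \<in> X. f x = n} \<in> \<I>}"

definition b_ideal :: "'a set \<Rightarrow> 'a set set \<Rightarrow> ('a \<Rightarrow> nat) rel" where
  "b_ideal X \<I> = least_card {\<F>. \<F> \<subseteq> ideal_to_one X \<I> \<and>
     \<not> (\<exists>g\<in>ideal_to_one X \<I>. \<forall>f\<in>\<F>. ideal_le X \<I> g f)}"

definition add_ideal :: "'a set set \<Rightarrow> 'a set rel" where
  "add_ideal \<I> = least_card {\<A>. \<A> \<subseteq> \<I> \<and> \<Union>\<A> \<notin> \<I>}"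

definition pseudointersection_number :: "nat set rel" where
  "pseudointersection_number = least_card {\<A> :: nat set set. (\<forall>A\<in>\<A>. infinite A) \<and>
     (\<forall>\<B>. \<B> \<subseteq> \<A> \<and> finite \<B> \<longrightarrow> infinite (\<Inter>\<B>)) \<and>
     \<not> (\<exists>S. infinite S \<and> (\<forall>A\<in>\<A>. finite (S - A)))}"

subsection \<open>\<open>\<sigma>\<close>-ideals on the Cantor space\<close>

text \<open>The library's topology on \<open>nat \<Rightarrow> bool\<close> is the product of the discrete topologies.\<close>

type_synonym cantor = "nat \<Rightarrow> bool"

definition nowhere_dense :: "'a::topological_space set \<Rightarrow> bool" where
  "nowhere_dense A \<longleftrightarrow> interior (closure A) = {}"

definition meager_sets :: "cantor set set" where
  "meager_sets = {A. \<exists>\<K>. countable \<K> \<and> (\<forall>K\<in>\<K>. nowhere_dense K) \<and> A = \<Union>\<K>}"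

definition cantor_measure :: "cantor measure" where
  "cantor_measure = PiM UNIV (\<lambda>_. uniform_count_measure UNIV)"

instance bool :: second_countable_topology
proof
  show "\<exists>B::bool set set. countable B \<and> open = generate_topology B"
    by (intro exI[of _ "range (\<lambda>a. {..< a}) \<union> range (\<lambda>a. {a <..})"])
      (auto simp: open_bool_def)
qed

lemma sets_cantor_measure: "sets cantor_measure = sets borel"
proof -
  have "sets (uniform_count_measure (UNIV :: bool set)) = sets borel"
    by (simp add: sets_uniform_count_measure sets_borel_eq_count_space)
  then have "sets cantor_measure = sets (PiM UNIV (\<lambda>_::nat. borel :: bool measure))"
    unfolding cantor_measure_def by (intro sets_PiM_cong) auto
  also have "\<dots> = sets borel"
    by (rule sets_PiM_equal_borel)
  finally show ?thesis .
qed

lemma prob_space_cantor_measure: "prob_space cantor_measure"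
  unfolding cantor_measure_def
  by (intro prob_space_PiM prob_space_uniform_count_measure) auto

definition sigma_closed_null_sets :: "cantor set set" where
  "sigma_closed_null_sets = {A. \<exists>\<K>. countable \<K> \<and>
     (\<forall>K\<in>\<K>. compact K \<and> K \<in> null_sets cantor_measure) \<and> A \<subseteq> \<Union>\<K>}"

definition countable_sets :: "cantor set set" where
  "countable_sets = {A. countable A}"

subsection \<open>The ideals NWD, NULL and CTBL on a dense set\<close>

definition closure_ideal :: "cantor set \<Rightarrow> cantor set set \<Rightarrow> cantor set set" where
  "closure_ideal D I = {A. A \<subseteq> D \<and> closure A \<in> I}"

definition NWD :: "cantor set \<Rightarrow> cantor set set" where
  "NWD D = closure_ideal D meager_sets"

definition NULL :: "cantor set \<Rightarrow> cantor set set" where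
  "NULL D = closure_ideal D sigma_closed_null_sets"

definition CTBL :: "cantor set \<Rightarrow> cantor set set" where
  "CTBL D = closure_ideal D countable_sets"

end

theory Submission
  imports Defs
begin

text \<open>Write \<open>E\<^sub>n = {f \<le> n}\<close> and \<open>C\<^sub>n = {g \<le> n}\<close>; then \<open>g\<close> lies below \<open>f\<close> modulo \<open>J\<close> iff
  \<open>\<Union>\<^sub>n (E\<^sub>n - C\<^sub>n) \<in> J\<close>.

  Upper bounds: let \<open>\<A>\<close> be a family of tail sets, each a countable union of closed members of the
  \<open>\<sigma>\<close>-ideal \<open>I\<close>, with \<open>\<Union>\<A> \<notin> I\<close>. For \<open>A \<in> \<A>\<close> choose subsets \<open>E\<^sub>n\<close> of \<open>D\<close> whose closures
  contain the pieces of \<open>A\<close>. For a common lower bound \<open>g\<close>, the closure of \<open>\<Union>\<^sub>n (E\<^sub>n - C\<^sub>n)\<close> misses a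
  cylinder, so inside that cylinder \<open>A\<close> is contained in \<open>\<Union>\<^sub>n cl C\<^sub>n\<close>; as \<open>A\<close> is a tail set, it is contained
  in the tail saturation of \<open>\<Union>\<^sub>n cl C\<^sub>n\<close>, a member of \<open>I\<close> independent of \<open>A\<close>. Hence
  \<open>\<bb>(J\<^sub>I) \<le> |\<A>|\<close>.

  For NULL this gives, for \<open>\<kappa> < \<bb>(NULL)\<close>, that \<open>\<kappa>\<close> many sets \<open>{y. y i = 0 for almost all i \<in> H}\<close>
  with \<open>H\<close> infinite are covered by countably many closed null sets. By the Baire category theorem the gaps of the
  sets \<open>H\<close> are then bounded by a single function modulo finite. Coding \<open>x\<close> by the set \<open>H\<close> of its
  initial segments, a closed set of positive measure disjoint from the cover and Bessel's inequality yield
  a slalom of a width known in advance that predicts infinitely many blocks of each of \<open>\<kappa>\<close> many \<open>x\<close>; diagonalising, one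
  obtains a single point that agrees with each of them on infinitely many blocks. With the description of
  meager sets by blocks this gives \<open>\<kappa> < add(\<M>)\<close>.

  Lower bounds: if eventually \<open>E\<^sub>n \<subseteq> C\<^sub>n\<close> for each \<open>f\<close>, then \<open>C\<close> yields a lower bound. Such \<open>C\<^sub>n\<close>
  come from a block description of a meager set covering all \<open>cl E\<^sub>n\<close>, or from a pseudointersection of
  sets of clopen sets of almost full measure avoiding the \<open>E\<^sub>n\<close>.\<close>

subsection \<open>Cylinders and blocks in the Cantor space\<close>

definition cyl :: "cantor \<Rightarrow> nat \<Rightarrow> cantor set" where
  "cyl x l = {y. \<forall>i<l. y i = x i}"

definition splice :: "nat \<Rightarrow> cantor \<Rightarrow> cantor \<Rightarrow> cantor" where
  "splice l x y = (\<lambda>i. if i < l then x i else y i)"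

lemma cyl_self [simp]: "x \<in> cyl x l"
  by (simp add: cyl_def)

lemma splice_in_cyl [simp]: "splice l x y \<in> cyl x l"
  by (simp add: cyl_def splice_def)

lemma cyl_eqI: "y \<in> cyl x l \<Longrightarrow> cyl y l = cyl x l"
  by (auto simp: cyl_def)

lemma cyl_antimono: "k \<le> l \<Longrightarrow> cyl x l \<subseteq> cyl x k"
  by (auto simp: cyl_def)

lemma open_bool_set [simp]: "open (A :: bool set)"
proof -
  have "open {..< True}" "open {False <..}"
    by (auto simp: open_bool_def intro: generate_topology.intros)
  moreover have "{..< True} = {False}" "{False <..} = {True}" by auto
  moreover have "A = (\<Union>b\<in>A. if b then {True} else {False})" by auto
  ultimately show ?thesis by (metis (full_types) open_UN)
qed

lemma open_coord_set: "open {y :: cantor. P (y i)}"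
proof -
  have "continuous_on UNIV (\<lambda>y :: cantor. y i)"
    by (rule continuous_on_product_coordinates)
  then have "open ((\<lambda>y :: cantor. y i) -` {b. P b})"
    by (intro open_vimage) auto
  then show ?thesis by (simp add: vimage_def)
qed

lemma open_cyl [simp]: "open (cyl x l)"
proof -
  have "cyl x l = (\<Inter>i\<in>{..<l}. {y. y i = x i})"
    by (auto simp: cyl_def)
  moreover have "open (\<Inter>i\<in>{..<l}. {y. y i = x i})"
    using open_coord_set[where P = "\<lambda>b. b = c" for c] by (intro open_INT) auto
  ultimately show ?thesis by simp
qed

lemma open_contains_cyl:
  assumes "open U" "x \<in> U"
  shows "\<exists>l. cyl x l \<subseteq> U"
proof -
  have "openin (product_topology (\<lambda>i::nat. euclidean :: bool topology) UNIV) U"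
    using assms(1) by (simp add: open_fun_def)
  then obtain V where V: "finite {i. V i \<noteq> UNIV}" "x \<in> Pi\<^sub>E UNIV V" "Pi\<^sub>E UNIV V \<subseteq> U"
    using assms(2) product_topology_open_contains_basis[of "\<lambda>i::nat. euclidean :: bool topology" UNIV U x]
    by auto
  obtain l where l: "\<forall>i. V i \<noteq> UNIV \<longrightarrow> i < l"
    using V(1) unfolding finite_nat_set_iff_bounded by blast
  have "cyl x l \<subseteq> Pi\<^sub>E UNIV V"
  proof
    fix y assume y: "y \<in> cyl x l"
    show "y \<in> Pi\<^sub>E UNIV V"
    proof (rule PiE_I)
      fix i :: nat
      show "y i \<in> V i"
      proof (cases "i < l")
        case True
        then have "y i = x i" using y by (simp add: cyl_def)
        then show ?thesis using V(2) by auto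
      qed (use l in auto)
    qed auto
  qed
  then show ?thesis using V(3) by blast
qed

lemma open_cyl_iff: "open U \<longleftrightarrow> (\<forall>x\<in>U. \<exists>l. cyl x l \<subseteq> U)"
proof
  assume *: "\<forall>x\<in>U. \<exists>l. cyl x l \<subseteq> U"
  then obtain l where l: "\<And>x. x \<in> U \<Longrightarrow> cyl x (l x) \<subseteq> U"
    by metis
  have "U = (\<Union>x\<in>U. cyl x (l x))"
  proof
    show "U \<subseteq> (\<Union>x\<in>U. cyl x (l x))" by (auto intro: cyl_self)
    show "(\<Union>x\<in>U. cyl x (l x)) \<subseteq> U" using l by blast
  qed
  moreover have "open (\<Union>x\<in>U. cyl x (l x))"
    by (intro open_UN ballI open_cyl)
  ultimately show "open U" by simp
qed (simp add: open_contains_cyl)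

lemma closed_cyl_iff: "closed C \<longleftrightarrow> (\<forall>x. x \<notin> C \<longrightarrow> (\<exists>l. cyl x l \<inter> C = {}))"
  unfolding closed_def open_cyl_iff by (auto simp: disjoint_eq_subset_Compl)

lemma closure_cyl_iff: "x \<in> closure A \<longleftrightarrow> (\<forall>l. cyl x l \<inter> A \<noteq> {})"
proof
  assume x: "x \<in> closure A"
  show "\<forall>l. cyl x l \<inter> A \<noteq> {}"
  proof
    fix l
    have "cyl x l \<inter> closure A \<noteq> {}" using x cyl_self by blast
    then show "cyl x l \<inter> A \<noteq> {}" using open_Int_closure_eq_empty[OF open_cyl] by blast
  qed
next
  assume *: "\<forall>l. cyl x l \<inter> A \<noteq> {}"
  show "x \<in> closure A"
  proof (rule ccontr)
    assume "x \<notin> closure A"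
    then obtain l where "cyl x l \<subseteq> - closure A"
      using open_contains_cyl[of "- closure A" x] by auto
    then show False using * closure_subset by blast
  qed
qed

lemma closed_cyl [simp]: "closed (cyl x l)"
  unfolding closed_cyl_iff
proof (intro allI impI)
  fix y assume "y \<notin> cyl x l"
  then have "cyl y l \<inter> cyl x l = {}" by (auto simp: cyl_def)
  then show "\<exists>k. cyl y k \<inter> cyl x l = {}" ..
qed

lemma compact_cantor: "closed (C :: cantor set) \<Longrightarrow> compact C"
proof -
  assume C: "closed C"
  have b: "compact_space (euclidean :: bool topology)"
    unfolding compact_space_def by (simp add: finite_imp_compact)
  have "compact_space (product_topology (\<lambda>i::nat. euclidean :: bool topology) UNIV)"
    using b by (simp add: compact_space_product_topology)
  then have "compact (UNIV :: cantor set)"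
    by (simp add: compact_space_def euclidean_product_topology)
  then show ?thesis using compact_Int_closed[OF _ C] by fastforce
qed

lemma interior_empty_cyl_iff: "interior A = {} \<longleftrightarrow> (\<forall>x l. \<not> cyl x l \<subseteq> A)"
proof
  assume "interior A = {}"
  then show "\<forall>x l. \<not> cyl x l \<subseteq> A"
    using interior_maximal[OF _ open_cyl] cyl_self by blast
next
  assume *: "\<forall>x l. \<not> cyl x l \<subseteq> A"
  show "interior A = {}"
  proof (rule ccontr)
    assume "interior A \<noteq> {}"
    then obtain x where "x \<in> interior A" by blast
    then obtain l where "cyl x l \<subseteq> interior A" using open_contains_cyl[of "interior A" x] by auto
    then show False using * interior_subset by blast
  qed
qed

lemma finite_range_trunc: "finite (range (\<lambda>y. splice l y (\<lambda>_. False)))"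
proof -
  have "range (\<lambda>y. splice l y (\<lambda>_. False)) \<subseteq> (\<lambda>S i. i \<in> S) ` Pow {..<l}"
  proof
    fix z assume "z \<in> range (\<lambda>y. splice l y (\<lambda>_. False))"
    then have "{i. z i} \<subseteq> {..<l}" by (auto simp: splice_def split: if_splits)
    then show "z \<in> (\<lambda>S i. i \<in> S) ` Pow {..<l}"
      by (intro image_eqI[where x = "{i. z i}"]) auto
  qed
  then show ?thesis by (rule finite_subset) auto
qed

lemma nowhere_dense_iff:
  "nowhere_dense N \<longleftrightarrow> (\<forall>x l. \<exists>y\<in>cyl x l. \<exists>k. cyl y k \<inter> N = {})"
proof -
  have "cyl x l \<subseteq> closure N \<longleftrightarrow> \<not> (\<exists>y\<in>cyl x l. \<exists>k. cyl y k \<inter> N = {})" for x l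
    unfolding subset_iff closure_cyl_iff by blast
  then show ?thesis
    unfolding nowhere_dense_def interior_empty_cyl_iff by simp
qed

lemma nowhere_dense_closed_iff: "closed N \<Longrightarrow> nowhere_dense N \<longleftrightarrow> (\<forall>x l. \<not> cyl x l \<subseteq> N)"
  by (simp add: nowhere_dense_def interior_empty_cyl_iff)

lemma nowhere_dense_Un:
  assumes "nowhere_dense M" "nowhere_dense (N :: cantor set)"
  shows "nowhere_dense (M \<union> N)"
  unfolding nowhere_dense_iff
proof (intro allI)
  fix x l
  obtain y k where y: "y \<in> cyl x l" "cyl y k \<inter> M = {}"
    using assms(1) unfolding nowhere_dense_iff by metis
  obtain z j where z: "z \<in> cyl y (max k l)" "cyl z j \<inter> N = {}"
    using assms(2) unfolding nowhere_dense_iff by metis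
  have "z \<in> cyl x l" using y z by (auto simp: cyl_def)
  moreover have "cyl z (max j k) \<inter> (M \<union> N) = {}"
  proof -
    have "cyl z (max j k) \<subseteq> cyl y k" "cyl z (max j k) \<subseteq> cyl z j" using z by (auto simp: cyl_def)
    then show ?thesis using y z by blast
  qed
  ultimately show "\<exists>y\<in>cyl x l. \<exists>k. cyl y k \<inter> (M \<union> N) = {}" by blast
qed

lemma nowhere_dense_empty: "nowhere_dense ({} :: cantor set)"
  by (simp add: nowhere_dense_def)

lemma nowhere_dense_subset: "nowhere_dense N \<Longrightarrow> M \<subseteq> N \<Longrightarrow> nowhere_dense (M :: cantor set)"
  unfolding nowhere_dense_iff by blast

lemma nowhere_dense_UN:
  "finite S \<Longrightarrow> (\<And>i. i \<in> S \<Longrightarrow> nowhere_dense (N i :: cantor set)) \<Longrightarrow> nowhere_dense (\<Union>i\<in>S. N i)"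
  by (induction S rule: finite_induct) (auto intro: nowhere_dense_Un nowhere_dense_empty)

definition misses :: "cantor \<Rightarrow> (nat \<Rightarrow> nat) \<Rightarrow> nat \<Rightarrow> cantor set" where
  "misses x a n = {y. \<forall>m\<ge>n. \<exists>i. a m \<le> i \<and> i < a (Suc m) \<and> y i \<noteq> x i}"

definition blockset :: "cantor \<Rightarrow> (nat \<Rightarrow> nat) \<Rightarrow> cantor set" where
  "blockset x a = (\<Union>n. misses x a n)"

definition captures :: "cantor \<Rightarrow> (nat \<Rightarrow> nat) \<Rightarrow> cantor \<Rightarrow> (nat \<Rightarrow> nat) \<Rightarrow> bool" where
  "captures x b x' a \<longleftrightarrow> (\<exists>M. \<forall>m\<ge>M. \<exists>k. b m \<le> a k \<and> a (Suc k) \<le> b (Suc m) \<and>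
     (\<forall>i. a k \<le> i \<and> i < a (Suc k) \<longrightarrow> x i = x' i))"

lemma closed_misses: "closed (misses x a n)"
  unfolding closed_cyl_iff
proof (intro allI impI)
  fix y assume "y \<notin> misses x a n"
  then obtain m where m: "m \<ge> n" "\<forall>i. a m \<le> i \<and> i < a (Suc m) \<longrightarrow> y i = x i"
    by (auto simp: misses_def)
  have "cyl y (a (Suc m)) \<inter> misses x a n = {}"
  proof (rule ccontr)
    assume "cyl y (a (Suc m)) \<inter> misses x a n \<noteq> {}"
    then obtain z where z: "z \<in> cyl y (a (Suc m))" "z \<in> misses x a n" by blast
    then obtain i where "a m \<le> i" "i < a (Suc m)" "z i \<noteq> x i" using m(1) by (auto simp: misses_def)
    then show False using z(1) m(2) by (auto simp: cyl_def)
  qed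
  then show "\<exists>l. cyl y l \<inter> misses x a n = {}" ..
qed

lemma blockset_no_cyl:
  assumes "strict_mono a"
  shows "\<not> cyl y l \<subseteq> blockset x a"
proof
  assume "cyl y l \<subseteq> blockset x a"
  then have "splice l y x \<in> blockset x a" using splice_in_cyl by blast
  then obtain n where n: "splice l y x \<in> misses x a n" by (auto simp: blockset_def)
  have "max l n \<ge> n" by simp
  then have "\<exists>i. a (max l n) \<le> i \<and> i < a (Suc (max l n)) \<and> splice l y x i \<noteq> x i"
    using n unfolding misses_def by blast
  then obtain i where i: "a (max l n) \<le> i" "splice l y x i \<noteq> x i" by blast
  have "l \<le> a (max l n)" using strict_mono_imp_increasing[OF assms, of "max l n"] by simp
  then show False using i by (auto simp: splice_def)
qed

lemma misses_nowhere_dense: "strict_mono a \<Longrightarrow> nowhere_dense (misses x a n)"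
  unfolding nowhere_dense_closed_iff[OF closed_misses]
  using blockset_no_cyl[of a _ _ x] unfolding blockset_def by blast

lemma blockset_meager: "strict_mono a \<Longrightarrow> blockset x a \<in> meager_sets"
  unfolding meager_sets_def blockset_def
  by (auto intro!: exI[of _ "range (misses x a)"] misses_nowhere_dense)

lemma blockset_tail:
  assumes "strict_mono a" "y \<in> blockset x a" "finite {i. z i \<noteq> y i}"
  shows "z \<in> blockset x a"
proof -
  obtain n where n: "y \<in> misses x a n" using assms(2) by (auto simp: blockset_def)
  obtain l where l: "\<forall>i. z i \<noteq> y i \<longrightarrow> i < l"
    using assms(3) unfolding finite_nat_set_iff_bounded by blast
  have "z \<in> misses x a (max l n)"
    unfolding misses_def
  proof (intro CollectI allI impI)
    fix m assume m: "max l n \<le> m"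
    then obtain i where i: "a m \<le> i" "i < a (Suc m)" "y i \<noteq> x i"
      using n by (auto simp: misses_def)
    have "l \<le> i" using strict_mono_imp_increasing[OF assms(1), of m] m i(1) by simp
    then have "z i = y i" using l by force
    then show "\<exists>i. a m \<le> i \<and> i < a (Suc m) \<and> z i \<noteq> x i" using i by auto
  qed
  then show ?thesis by (auto simp: blockset_def)
qed

lemma escape_all_prefixes:
  assumes N: "nowhere_dense N"
  shows "\<exists>k>l. \<exists>w :: cantor. \<forall>y. (\<forall>i. l \<le> i \<and> i < k \<longrightarrow> y i = w i) \<longrightarrow> y \<notin> N"
proof -
  have "\<exists>k>l. \<exists>w :: cantor. \<forall>y. splice l y (\<lambda>_. False) \<in> S \<longrightarrow> (\<forall>i. l \<le> i \<and> i < k \<longrightarrow> y i = w i) \<longrightarrow> y \<notin> N"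
    if "finite S" for S
    using that
  proof (induction S rule: finite_induct)
    case empty
    then show ?case by auto
  next
    case (insert s S)
    then obtain k w where k: "k > l"
      and w: "\<And>y. splice l y (\<lambda>_. False) \<in> S \<Longrightarrow> (\<forall>i. l \<le> i \<and> i < k \<longrightarrow> y i = w i) \<Longrightarrow> y \<notin> N"
      by auto
    obtain z j where z: "z \<in> cyl (splice l s w) k" "cyl z j \<inter> N = {}"
      using N unfolding nowhere_dense_iff by metis
    show ?case
    proof (intro exI conjI allI impI)
      show "l < max j k" using k by simp
      fix y
      assume y: "splice l y (\<lambda>_. False) \<in> insert s S" "\<forall>i. l \<le> i \<and> i < max j k \<longrightarrow> y i = z i"
      show "y \<notin> N"
      proof (cases "splice l y (\<lambda>_. False) \<in> S")
        case True
        have "\<forall>i. l \<le> i \<and> i < k \<longrightarrow> y i = w i"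
          using y(2) z(1) by (auto simp: cyl_def splice_def)
        then show ?thesis using w True by blast
      next
        case False
        then have s: "s = splice l y (\<lambda>_. False)" using y(1) by simp
        have "y i = z i" if "i < max j k" for i
        proof (cases "i < l")
          case True
          then have "z i = s i" using z(1) k by (auto simp: cyl_def splice_def)
          then show ?thesis using s True by (simp add: splice_def)
        qed (use y(2) that in auto)
        then have "y \<in> cyl z j" by (auto simp: cyl_def)
        then show ?thesis using z(2) by blast
      qed
    qed
  qed
  from this[OF finite_range_trunc[of l]] show ?thesis by auto
qed

lemma block_index:
  fixes a :: "nat \<Rightarrow> nat"
  assumes "strict_mono a" "a k \<le> i" "i < a (Suc k)"
  shows "(LEAST k. i < a (Suc k)) = k"
proof (rule Least_equality)
  fix j assume "i < a (Suc j)"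
  then have "a k < a (Suc j)" using assms(2) by simp
  then show "k \<le> j" using assms(1) by (simp add: strict_mono_less)
qed (use assms in auto)

lemma nowhere_dense_blocks:
  assumes "\<And>n. nowhere_dense (E n :: cantor set)"
  shows "\<exists>x a. strict_mono a \<and> (\<forall>k y. (\<forall>i. a k \<le> i \<and> i < a (Suc k) \<longrightarrow> y i = x i) \<longrightarrow> y \<notin> E (a k))"
proof -
  obtain L w where L: "\<And>l. L l > l"
    and w: "\<And>l y. (\<forall>i. l \<le> i \<and> i < L l \<longrightarrow> y i = w l i) \<Longrightarrow> y \<notin> E l"
  proof -
    have "\<forall>l. \<exists>k w. k > l \<and> (\<forall>y. (\<forall>i. l \<le> i \<and> i < k \<longrightarrow> y i = w i) \<longrightarrow> y \<notin> E l)"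
      using escape_all_prefixes[OF assms] by blast
    then obtain L w where "\<And>l. l < L l \<and> (\<forall>y. (\<forall>i. l \<le> i \<and> i < L l \<longrightarrow> y i = w l i) \<longrightarrow> y \<notin> E l)"
      by (auto simp only: choice_iff)
    then show thesis using that by blast
  qed
  define a where "a k = (L ^^ k) 0" for k
  have aS: "a (Suc k) = L (a k)" for k by (simp add: a_def)
  have a: "strict_mono a" using L by (simp add: strict_mono_Suc_iff aS)
  define x where "x i = w (a (LEAST k. i < a (Suc k))) i" for i
  have "y \<notin> E (a k)" if y: "\<forall>i. a k \<le> i \<and> i < a (Suc k) \<longrightarrow> y i = x i" for k y
  proof (rule w)
    show "\<forall>i. a k \<le> i \<and> i < L (a k) \<longrightarrow> y i = w (a k) i"
      using y block_index[OF a, of k] by (auto simp: x_def aS)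
  qed
  then show ?thesis using a by blast
qed

lemma blocks_cover:
  assumes "strict_mono a" "\<And>m n. m \<le> n \<Longrightarrow> E m \<subseteq> E n"
    "\<And>k y. (\<forall>i. a k \<le> i \<and> i < a (Suc k) \<longrightarrow> y i = x i) \<Longrightarrow> y \<notin> E (a k)"
  shows "(\<Union>n. E n) \<subseteq> blockset x a"
proof
  fix y assume "y \<in> (\<Union>n. E n)"
  then obtain n where n: "y \<in> E n" by blast
  have "y \<in> misses x a n"
    unfolding misses_def
  proof (intro CollectI allI impI)
    fix m assume "n \<le> m"
    then have "n \<le> a m" using strict_mono_imp_increasing[OF assms(1), of m] by simp
    then have "y \<in> E (a m)" using n assms(2) by blast
    then show "\<exists>i. a m \<le> i \<and> i < a (Suc m) \<and> y i \<noteq> x i" using assms(3) by blast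
  qed
  then show "y \<in> blockset x a" by (auto simp: blockset_def)
qed

lemma meager_blockset:
  assumes "A \<in> meager_sets"
  shows "\<exists>x a. strict_mono a \<and> A \<subseteq> blockset x a"
proof -
  obtain K where K: "countable K" "\<forall>N\<in>K. nowhere_dense N" "A = \<Union>K"
    using assms by (auto simp: meager_sets_def)
  define e where "e = from_nat_into (insert {} K)"
  have e: "range e = insert {} K"
    unfolding e_def using K(1) by (intro range_from_nat_into) auto
  have nd: "nowhere_dense (e i)" for i
    using K(2) e nowhere_dense_empty by (metis insert_iff rangeI)
  define E where "E n = (\<Union>i\<in>{..n}. e i)" for n
  have "nowhere_dense (E n)" for n
    unfolding E_def by (rule nowhere_dense_UN) (auto simp: nd)
  then obtain x a where a: "strict_mono a" and xa:
    "\<And>k y. (\<forall>i. a k \<le> i \<and> i < a (Suc k) \<longrightarrow> y i = x i) \<Longrightarrow> y \<notin> E (a k)"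
    using nowhere_dense_blocks[of E] by auto
  have Em: "E m \<subseteq> E n" if "m \<le> n" for m n
    using that unfolding E_def by (intro UN_mono) auto
  have "(\<Union>n. E n) \<subseteq> blockset x a"
  proof (rule blocks_cover)
    show "y \<notin> E (a k)" if "\<forall>i. a k \<le> i \<and> i < a (Suc k) \<longrightarrow> y i = x i" for k y
      using xa[of k y] that by simp
  qed (use a Em in auto)
  moreover have "A \<subseteq> \<Union>(range e)"
    unfolding K(3) e by blast
  moreover have "\<Union>(range e) \<subseteq> (\<Union>n. E n)"
    unfolding E_def by blast
  ultimately have "A \<subseteq> blockset x a" by (meson subset_trans)
  with a show ?thesis by (intro exI conjI)
qed

lemma meager_subset: "A \<in> meager_sets \<Longrightarrow> B \<subseteq> A \<Longrightarrow> B \<in> meager_sets"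
proof -
  assume "A \<in> meager_sets" "B \<subseteq> A"
  then obtain K where K: "countable K" "\<forall>N\<in>K. nowhere_dense N" "A = \<Union>K"
    by (auto simp: meager_sets_def)
  have "B = \<Union>((\<lambda>N. N \<inter> B) ` K)" using K(3) \<open>B \<subseteq> A\<close> by auto
  moreover have "nowhere_dense (N \<inter> B)" if "N \<in> K" for N
    by (rule nowhere_dense_subset[of N]) (use K(2) that in auto)
  ultimately show ?thesis
    unfolding meager_sets_def using countable_image[OF K(1), of "\<lambda>N. N \<inter> B"]
    by (intro CollectI exI[of _ "(\<lambda>N. N \<inter> B) ` K"] conjI) auto
qed

lemma meager_UN:
  assumes "\<And>n :: nat. A n \<in> meager_sets"
  shows "(\<Union>n. A n) \<in> meager_sets"
proof -
  have "\<forall>n. \<exists>K. countable K \<and> (\<forall>N\<in>K. nowhere_dense N) \<and> A n = \<Union>K"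
    using assms unfolding meager_sets_def by simp
  then obtain K where "\<forall>n. countable (K n) \<and> (\<forall>N\<in>K n. nowhere_dense N) \<and> A n = \<Union>(K n)"
    by (auto simp only: choice_iff)
  then have K: "\<And>n. countable (K n)" "\<And>n. \<forall>N\<in>K n. nowhere_dense N" "\<And>n. A n = \<Union>(K n)"
    by blast+
  have "countable (\<Union>n. K n)" using K(1) by auto
  moreover have "\<forall>N\<in>(\<Union>n. K n). nowhere_dense N" using K(2) by blast
  moreover have "(\<Union>n. A n) = \<Union>(\<Union>n. K n)" unfolding K(3) by blast
  ultimately show ?thesis
    unfolding meager_sets_def by (intro CollectI exI[of _ "\<Union>n. K n"] conjI)
qed

lemma blockset_mono:
  assumes "captures x b x' a" "strict_mono a" "strict_mono b"
  shows "blockset x' a \<subseteq> blockset x b"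
proof
  fix y assume "y \<in> blockset x' a"
  then obtain n where n: "y \<in> misses x' a n" by (auto simp: blockset_def)
  obtain M where M: "\<And>m. m \<ge> M \<Longrightarrow> \<exists>k. b m \<le> a k \<and> a (Suc k) \<le> b (Suc m) \<and>
     (\<forall>i. a k \<le> i \<and> i < a (Suc k) \<longrightarrow> x i = x' i)"
    using assms(1) unfolding captures_def by blast
  have "y \<in> misses x b (max M (a n))"
    unfolding misses_def
  proof (intro CollectI allI impI)
    fix m assume m: "max M (a n) \<le> m"
    then obtain k where k: "b m \<le> a k" "a (Suc k) \<le> b (Suc m)"
      "\<forall>i. a k \<le> i \<and> i < a (Suc k) \<longrightarrow> x i = x' i"
      using M[of m] by auto
    have "a n \<le> a k" using m k(1) strict_mono_imp_increasing[OF assms(3), of m] by simp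
    then have "n \<le> k" using assms(2) by (simp add: strict_mono_less_eq)
    then obtain i where "a k \<le> i" "i < a (Suc k)" "y i \<noteq> x' i"
      using n by (auto simp: misses_def)
    then show "\<exists>i. b m \<le> i \<and> i < b (Suc m) \<and> y i \<noteq> x i"
      using k by (intro exI[of _ i]) auto
  qed
  then show "y \<in> blockset x b" by (auto simp: blockset_def)
qed

text \<open>If infinitely many blocks of \<open>b\<close> capture no block of \<open>a\<close>, a point that agrees with \<open>x\<close> on a
  sparse set of such blocks and differs from \<open>x'\<close> everywhere else separates the two sets.\<close>

lemma captures_if_subset:
  assumes sub: "blockset x' a \<subseteq> blockset x b" and a: "strict_mono a" and b: "strict_mono b"
  shows "captures x b x' a"
proof (rule ccontr)
  define good where "good m \<longleftrightarrow> (\<exists>k. b m \<le> a k \<and> a (Suc k) \<le> b (Suc m) \<and>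
     (\<forall>i. a k \<le> i \<and> i < a (Suc k) \<longrightarrow> x i = x' i))" for m
  assume "\<not> captures x b x' a"
  then have bad: "\<exists>m\<ge>M. \<not> good m" for M
    unfolding captures_def good_def by blast
  have "\<exists>f. \<forall>n. \<not> good (f n) \<and> (f n < f (Suc n) \<and> (\<exists>k. b (Suc (f n)) \<le> a k \<and> a k \<le> b (f (Suc n))))"
  proof (rule dependent_nat_choice)
    show "\<exists>m. \<not> good m" using bad by blast
    fix m
    obtain m' where m': "m' \<ge> max (Suc m) (a (b (Suc m)))" "\<not> good m'" using bad by blast
    have "b (Suc m) \<le> a (b (Suc m))" by (rule strict_mono_imp_increasing[OF a])
    moreover have "a (b (Suc m)) \<le> b m'"
      using m'(1) strict_mono_imp_increasing[OF b, of m'] by simp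
    ultimately show "\<exists>m'. \<not> good m' \<and> (m < m' \<and> (\<exists>k. b (Suc m) \<le> a k \<and> a k \<le> b m'))"
      using m' by (intro exI[of _ m']) auto
  qed
  then obtain f where f: "\<And>n. \<not> good (f n)" "\<And>n. f n < f (Suc n)"
    "\<And>n. \<exists>k. b (Suc (f n)) \<le> a k \<and> a k \<le> b (f (Suc n))" by blast
  have fm: "strict_mono f" using f(2) by (simp add: strict_mono_Suc_iff)
  define P where "P i \<longleftrightarrow> (\<exists>n. b (f n) \<le> i \<and> i < b (Suc (f n)))" for i
  define y where "y i = (if P i then x i else \<not> x' i)" for i
  have "y \<notin> blockset x b"
  proof
    assume "y \<in> blockset x b"
    then obtain n where "y \<in> misses x b n" by (auto simp: blockset_def)
    moreover have "n \<le> f n" by (rule strict_mono_imp_increasing[OF fm])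
    ultimately obtain i where "b (f n) \<le> i" "i < b (Suc (f n))" "y i \<noteq> x i"
      by (auto simp: misses_def)
    moreover have "P i" using calculation by (auto simp: P_def)
    ultimately show False by (simp add: y_def)
  qed
  then have "y \<notin> misses x' a 0" using sub by (auto simp: blockset_def)
  then obtain k where k: "\<And>i. a k \<le> i \<Longrightarrow> i < a (Suc k) \<Longrightarrow> y i = x' i"
    by (auto simp: misses_def)
  have Pk: "P i" "x i = x' i" if "a k \<le> i" "i < a (Suc k)" for i
    using k[OF that] by (auto simp: y_def split: if_splits)
  have ak: "a k < a (Suc k)" using a by (simp add: strict_mono_less)
  obtain n where n: "b (f n) \<le> a k" "a k < b (Suc (f n))" using Pk(1)[of k] Pk(1)[of "a k"] ak by (auto simp: P_def)
  have "a (Suc k) \<le> b (Suc (f n))"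
  proof (rule ccontr)
    assume "\<not> ?thesis"
    then have "P (b (Suc (f n)))" using n by (intro Pk) auto
    then obtain n' where n': "b (f n') \<le> b (Suc (f n))" "b (Suc (f n)) < b (Suc (f n'))"
      by (auto simp: P_def)
    then have "f n < f n'" using b by (simp add: strict_mono_less)
    then have "Suc n \<le> n'" using fm by (simp add: strict_mono_less)
    then have "b (f (Suc n)) \<le> b (f n')" using b fm by (simp add: strict_mono_less_eq)
    moreover obtain j where j: "b (Suc (f n)) \<le> a j" "a j \<le> b (f (Suc n))" using f(3) by blast
    ultimately have "a j \<le> b (Suc (f n))" using n'(1) by simp
    then have "a j < a (Suc k)" using \<open>\<not> a (Suc k) \<le> b (Suc (f n))\<close> by simp
    moreover have "a k < a j" using n(2) j(1) by simp
    ultimately show False using a by (simp add: strict_mono_less)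
  qed
  then have "good (f n)" using n Pk(2) unfolding good_def by blast
  then show False using f(1) by blast
qed

subsection \<open>Bounding numbers of closure ideals\<close>

lemma finite_closed_cantor:
  assumes "finite (E :: cantor set)"
  shows "closed E"
proof -
  have "{x} = (\<Inter>l. cyl x l)" for x by (auto simp: cyl_def fun_eq_iff)
  then have "closed {x}" for x :: cantor by (metis closed_INT closed_cyl)
  then have "closed (\<Union>x\<in>E. {x})" using assms by (intro closed_UN) auto
  then show ?thesis by simp
qed

lemma least_card_le_member: "A \<in> \<C> \<Longrightarrow> least_card \<C> \<le>o |A|"
  using least_card_le[of \<C>] by auto

definition unbounded_below :: "'a set \<Rightarrow> 'a set set \<Rightarrow> ('a \<Rightarrow> nat) set \<Rightarrow> bool" where
  "unbounded_below X J F \<longleftrightarrow> F \<subseteq> ideal_to_one X J \<and>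
     \<not> (\<exists>g\<in>ideal_to_one X J. \<forall>f\<in>F. ideal_le X J g f)"

lemma b_ideal_le: "unbounded_below X J F \<Longrightarrow> b_ideal X J \<le>o |F|"
  unfolding b_ideal_def unbounded_below_def
  by (rule least_card_le_member) auto

lemma b_ideal_attained:
  assumes "unbounded_below X J F0"
  shows "\<exists>F. unbounded_below X J F \<and> b_ideal X J = |F|"
proof -
  have "{F. F \<subseteq> ideal_to_one X J \<and> \<not> (\<exists>g\<in>ideal_to_one X J. \<forall>f\<in>F. ideal_le X J g f)} \<noteq> {}"
    using assms unfolding unbounded_below_def by blast
  from least_card_attained[OF this] show ?thesis
    unfolding b_ideal_def unbounded_below_def by blast
qed

lemma natLeq_less_uncountable:
  assumes "\<not> countable A"
  shows "natLeq <o |A|"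
proof -
  have "\<not> |A| \<le>o natLeq"
  proof
    assume "|A| \<le>o natLeq"
    then have "|A| \<le>o |UNIV :: nat set|"
      by (rule ordLeq_ordIso_trans[OF _ ordIso_symmetric[OF card_of_nat]])
    then have "\<exists>f :: 'a \<Rightarrow> nat. inj_on f A" unfolding card_of_ordLeq[symmetric] by blast
    then show False using assms unfolding countable_def by blast
  qed
  then show ?thesis
    by (simp only: not_ordLeq_iff_ordLess[OF natLeq_Well_order card_of_Well_order])
qed

locale countable_ideal =
  fixes X :: "'a set" and J :: "'a set set"
  assumes countable: "countable X"
    and subset: "A \<in> J \<Longrightarrow> B \<subseteq> A \<Longrightarrow> B \<in> J"
    and Un: "A \<in> J \<Longrightarrow> B \<in> J \<Longrightarrow> A \<union> B \<in> J"
    and empty: "{} \<in> J"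
    and singleton: "x \<in> X \<Longrightarrow> {x} \<in> J"
begin

lemma finite_mem: "finite A \<Longrightarrow> A \<subseteq> X \<Longrightarrow> A \<in> J"
proof (induction A rule: finite_induct)
  case (insert x A)
  then show ?case using Un[of "{x}" A] singleton by simp
qed (rule empty)

definition rank :: "(nat \<Rightarrow> 'a set) \<Rightarrow> 'a \<Rightarrow> nat" where
  "rank E = (\<lambda>x\<in>X. LEAST n. x \<in> E n \<or> to_nat_on X x \<le> n)"

lemma rank_le: "x \<in> X \<Longrightarrow> x \<in> E n \<Longrightarrow> rank E x \<le> n"
  unfolding rank_def by (simp add: Least_le)

lemma rank_mem:
  assumes "\<And>n. E n \<in> J"
  shows "rank E \<in> ideal_to_one X J"
  unfolding ideal_to_one_def
proof (intro CollectI conjI allI)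
  show "rank E \<in> X \<rightarrow>\<^sub>E UNIV" by (simp add: rank_def)
  fix n
  have "{x \<in> X. to_nat_on X x \<le> n} \<in> J"
  proof (rule finite_mem)
    have "inj_on (to_nat_on X) {x \<in> X. to_nat_on X x \<le> n}"
      using inj_on_to_nat_on[OF countable] by (rule inj_on_subset) auto
    moreover have "finite (to_nat_on X ` {x \<in> X. to_nat_on X x \<le> n})"
      by (rule finite_subset[of _ "{..n}"]) auto
    ultimately show "finite {x \<in> X. to_nat_on X x \<le> n}" by (rule finite_imageD[rotated])
  qed auto
  then have "E n \<union> {x \<in> X. to_nat_on X x \<le> n} \<in> J" by (rule Un[OF assms])
  moreover have "{x \<in> X. rank E x = n} \<subseteq> E n \<union> {x \<in> X. to_nat_on X x \<le> n}"
  proof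
    fix x assume "x \<in> {x \<in> X. rank E x = n}"
    then have x: "x \<in> X" "(LEAST n. x \<in> E n \<or> to_nat_on X x \<le> n) = n" by (auto simp: rank_def)
    have "x \<in> E (to_nat_on X x) \<or> to_nat_on X x \<le> to_nat_on X x" by simp
    from LeastI[of "\<lambda>n. x \<in> E n \<or> to_nat_on X x \<le> n", OF this] x
    show "x \<in> E n \<union> {x \<in> X. to_nat_on X x \<le> n}" by simp
  qed
  ultimately show "{x \<in> X. rank E x = n} \<in> J" by (rule subset)
qed

lemma ideal_to_one_le:
  assumes "f \<in> ideal_to_one X J"
  shows "{x \<in> X. f x \<le> n} \<in> J"
proof (induction n)
  case 0
  then show ?case using assms by (simp add: ideal_to_one_def)
next
  case (Suc n)
  have "{x \<in> X. f x = Suc n} \<in> J" using assms by (simp add: ideal_to_one_def)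
  with Suc have "{x \<in> X. f x \<le> n} \<union> {x \<in> X. f x = Suc n} \<in> J" by (rule Un)
  moreover have "{x \<in> X. f x \<le> n} \<union> {x \<in> X. f x = Suc n} = {x \<in> X. f x \<le> Suc n}" by auto
  ultimately show ?case by simp
qed

lemma lower_bound:
  assumes C: "\<And>n. C n \<in> J" and F: "F \<subseteq> ideal_to_one X J"
    and ev: "\<And>f. f \<in> F \<Longrightarrow> \<exists>N. \<forall>n\<ge>N. {x \<in> X. f x \<le> n} \<subseteq> C n"
  shows "\<not> unbounded_below X J F"
proof -
  have "ideal_le X J (rank C) f" if f: "f \<in> F" for f
  proof -
    obtain N where N: "\<And>n. n \<ge> N \<Longrightarrow> {x \<in> X. f x \<le> n} \<subseteq> C n" using ev[OF f] by blast
    have "{x \<in> X. rank C x > f x} \<subseteq> {x \<in> X. f x \<le> N}"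
    proof
      fix x assume "x \<in> {x \<in> X. rank C x > f x}"
      then have x: "x \<in> X" "f x < rank C x" by auto
      have "x \<notin> C (f x)" using rank_le[OF x(1), of C "f x"] x(2) by auto
      then have "\<not> f x \<ge> N" using N[of "f x"] x(1) by auto
      then show "x \<in> {x \<in> X. f x \<le> N}" using x(1) by auto
    qed
    moreover have "{x \<in> X. f x \<le> N} \<in> J" using F f by (intro ideal_to_one_le) auto
    ultimately show ?thesis unfolding ideal_le_def by (rule subset[rotated])
  qed
  moreover have "rank C \<in> ideal_to_one X J" by (rule rank_mem) (rule C)
  ultimately show ?thesis unfolding unbounded_below_def by auto
qed

lemma unbounded_below_uncountable:
  assumes "unbounded_below X J F"
  shows "\<not> countable F"
proof
  assume cF: "countable F"
  have F: "F \<subseteq> ideal_to_one X J" using assms by (simp add: unbounded_below_def)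
  show False
  proof (cases "F = {}")
    case True
    have "\<not> unbounded_below X J F"
      by (rule lower_bound[of "\<lambda>_. {}"]) (use empty True in auto)
    then show False using assms by blast
  next
    case False
    define e where "e = from_nat_into F"
    have e: "range e = F" unfolding e_def using False cF by (rule range_from_nat_into)
    define C where "C m = (\<Union>k\<in>{..m}. {x \<in> X. e k x \<le> m})" for m
    have "(\<Union>k\<in>S. {x \<in> X. e k x \<le> m}) \<in> J" if "finite S" for S m
      using that
    proof (induction S rule: finite_induct)
      case (insert k S)
      have "e k \<in> ideal_to_one X J" using e F by blast
      then have "{x \<in> X. e k x \<le> m} \<union> (\<Union>k\<in>S. {x \<in> X. e k x \<le> m}) \<in> J"
        by (intro Un ideal_to_one_le insert)
      then show ?case by simp
    qed (simp add: empty)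
    then have "C m \<in> J" for m unfolding C_def by simp
    then have "\<not> unbounded_below X J F"
    proof (rule lower_bound[OF _ F])
      fix f assume "f \<in> F"
      then obtain k where "f = e k" using e by blast
      then have "\<forall>n\<ge>k. {x \<in> X. f x \<le> n} \<subseteq> C n" by (auto simp: C_def)
      then show "\<exists>N. \<forall>n\<ge>N. {x \<in> X. f x \<le> n} \<subseteq> C n" by blast
    qed
    then show False using assms by blast
  qed
qed

lemma cardSuc_le_b_ideal:
  assumes "unbounded_below X J F"
  shows "cardSuc natLeq \<le>o b_ideal X J"
proof -
  obtain F' where F': "unbounded_below X J F'" "b_ideal X J = |F'|"
    using b_ideal_attained[OF assms] by blast
  have "\<not> countable F'" by (rule unbounded_below_uncountable[OF F'(1)])
  then have "natLeq <o |F'|" by (rule natLeq_less_uncountable)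
  then show ?thesis
    unfolding F'(2) by (intro cardSuc_least natLeq_Card_order card_of_Card_order)
qed

end

locale cantor_ideal =
  fixes I :: "cantor set set"
  assumes subset: "A \<in> I \<Longrightarrow> B \<subseteq> A \<Longrightarrow> B \<in> I"
    and UN: "(\<And>n :: nat. E n \<in> I) \<Longrightarrow> (\<Union>n. E n) \<in> I"
    and singleton: "{x} \<in> I"
    and no_cyl: "A \<in> I \<Longrightarrow> \<not> cyl x l \<subseteq> A"
    and tail: "A \<in> I \<Longrightarrow> {y. \<exists>z\<in>A. finite {i. y i \<noteq> z i}} \<in> I"
begin

lemma empty: "{} \<in> I"
  using subset[OF singleton] by blast

lemma Un: "A \<in> I \<Longrightarrow> B \<in> I \<Longrightarrow> A \<union> B \<in> I"
proof -
  assume "A \<in> I" "B \<in> I"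
  then have "(\<Union>n. (if n = (0::nat) then A else B)) \<in> I" by (intro UN) auto
  then show ?thesis by (rule subset) (auto split: if_splits intro: exI[of _ "1::nat"])
qed

lemma countable_mem:
  assumes "countable A"
  shows "A \<in> I"
proof (cases "A = {}")
  case False
  have "(\<Union>n. {from_nat_into A n}) \<in> I" by (intro UN singleton)
  moreover have "(\<Union>n. {from_nat_into A n}) = A"
    using range_from_nat_into[OF False assms] by auto
  ultimately show ?thesis by simp
qed (simp add: empty)

lemma countable_ideal_closure_ideal:
  assumes "countable D"
  shows "countable_ideal D (closure_ideal D I)"
proof
  show "countable D" by fact
  show "A \<in> closure_ideal D I \<Longrightarrow> B \<subseteq> A \<Longrightarrow> B \<in> closure_ideal D I" for A B
    unfolding closure_ideal_def using subset[OF _ closure_mono] by blast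
  show "A \<in> closure_ideal D I \<Longrightarrow> B \<in> closure_ideal D I \<Longrightarrow> A \<union> B \<in> closure_ideal D I" for A B
    unfolding closure_ideal_def using Un by (simp add: closure_Un)
  show "{} \<in> closure_ideal D I" by (simp add: closure_ideal_def empty)
  show "{x} \<in> closure_ideal D I" if "x \<in> D" for x
  proof -
    have "closure {x} = {x}" by (simp add: closure_closed finite_closed_cantor)
    then show ?thesis using that by (simp add: closure_ideal_def singleton)
  qed
qed

end

lemma countable_tail: "countable {y :: cantor. finite {i. y i \<noteq> z i}}"
proof -
  have "{y. finite {i. y i \<noteq> z i}} \<subseteq> (\<lambda>S i. z i \<noteq> (i \<in> S)) ` {S :: nat set. finite S}"
  proof
    fix y assume "y \<in> {y. finite {i. y i \<noteq> z i}}"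
    then show "y \<in> (\<lambda>S i. z i \<noteq> (i \<in> S)) ` {S :: nat set. finite S}"
      by (intro image_eqI[where x = "{i. y i \<noteq> z i}"]) auto
  qed
  then show ?thesis
    using countable_Collect_finite countable_image countable_subset by blast
qed

lemma closed_approximation:
  assumes N: "closed N" and D: "closure D = (UNIV :: cantor set)"
  shows "\<exists>E\<subseteq>D. N \<subseteq> closure E \<and> closure E \<subseteq> N \<union> E"
proof -
  define t where "t n y = splice n y (\<lambda>_. False)" for n y
  have "\<exists>d. d \<in> D \<and> d \<in> cyl y n" for y n
    using D closure_cyl_iff[of y D] by auto
  then obtain d where d: "\<And>y n. d y n \<in> D" "\<And>y n. d y n \<in> cyl y n" by metis
  have dt: "d (t n y) n \<in> cyl y n" for n y
    using d(2)[of "t n y" n] by (simp add: cyl_def t_def splice_def)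
  define E where "E = (\<Union>n. (\<lambda>y. d (t n y) n) ` N)"
  have "N \<subseteq> closure E"
  proof
    fix y assume y: "y \<in> N"
    have "d (t l y) l \<in> cyl y l \<inter> E" for l
      using dt y unfolding E_def by blast
    then show "y \<in> closure E" unfolding closure_cyl_iff by blast
  qed
  moreover have "closure E \<subseteq> N \<union> E"
  proof
    fix z assume z: "z \<in> closure E"
    show "z \<in> N \<union> E"
    proof (cases "z \<in> N")
      case False
      then obtain l where l: "cyl z l \<inter> N = {}" using N unfolding closed_cyl_iff by blast
      define E' where "E' = (\<Union>n\<in>{..<l}. (\<lambda>y. d (t n y) n) ` N)"
      have "E' \<subseteq> (\<Union>n\<in>{..<l}. (\<lambda>s. d s n) ` range (t n))"
        unfolding E'_def by blast
      moreover have "finite (\<Union>n\<in>{..<l}. (\<lambda>s. d s n) ` range (t n))"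
        unfolding t_def by (intro finite_UN_I finite_lessThan finite_imageI finite_range_trunc)
      ultimately have fin: "finite E'" by (rule finite_subset)
      have "cyl z l \<inter> E \<subseteq> E'"
      proof
        fix w assume w: "w \<in> cyl z l \<inter> E"
        then obtain n y where ny: "y \<in> N" "w = d (t n y) n" unfolding E_def by blast
        have "n < l"
        proof (rule ccontr)
          assume "\<not> n < l"
          then have "y \<in> cyl z l" using w dt[of n y] ny(2) by (auto simp: cyl_def)
          then show False using l ny(1) by blast
        qed
        then show "w \<in> E'" using ny unfolding E'_def by blast
      qed
      moreover have "z \<in> closure (cyl z l \<inter> E)"
        unfolding closure_cyl_iff
      proof
        fix k
        have "cyl z (max k l) \<inter> E \<noteq> {}" using z unfolding closure_cyl_iff by blast
        moreover have "cyl z (max k l) \<subseteq> cyl z k \<inter> cyl z l" by (auto simp: cyl_def)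
        ultimately show "cyl z k \<inter> (cyl z l \<inter> E) \<noteq> {}" by blast
      qed
      ultimately have "z \<in> closure E'" by (rule closure_mono[THEN subsetD])
      moreover have "closure E' = E'" by (rule closure_closed[OF finite_closed_cantor[OF fin]])
      ultimately have "z \<in> E'" by simp
      then show ?thesis unfolding E'_def E_def by blast
    qed simp
  qed
  moreover have "E \<subseteq> D" using d(1) by (auto simp: E_def)
  ultimately show ?thesis by blast
qed

context cantor_ideal
begin

lemma closed_dense_subset:
  assumes "closed N" "N \<in> I" "countable D" "closure D = UNIV"
  shows "\<exists>E\<in>closure_ideal D I. N \<subseteq> closure E"
proof -
  obtain E where E: "E \<subseteq> D" "N \<subseteq> closure E" "closure E \<subseteq> N \<union> E"
    using closed_approximation[OF assms(1,4)] by blast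
  have "E \<in> I" using E(1) assms(3) countable_subset by (intro countable_mem) blast
  then have "closure E \<in> I" using Un[OF assms(2)] subset[OF _ E(3)] by blast
  then show ?thesis using E unfolding closure_ideal_def by blast
qed

lemma ex_unbounded_below:
  fixes \<A> :: "cantor set set"
  assumes D: "countable D" "closure D = UNIV"
    and cover: "\<And>A. A \<in> \<A> \<Longrightarrow> \<exists>N. (\<forall>n. closed (N n) \<and> N n \<in> I) \<and> A \<subseteq> (\<Union>n :: nat. N n)"
    and tail_inv: "\<And>A y z. A \<in> \<A> \<Longrightarrow> y \<in> A \<Longrightarrow> finite {i. z i \<noteq> y i} \<Longrightarrow> z \<in> A"
    and large: "\<Union>\<A> \<notin> I"
  shows "\<exists>F. unbounded_below D (closure_ideal D I) F \<and> |F| \<le>o |\<A>|"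
proof -
  interpret J: countable_ideal D "closure_ideal D I"
    by (rule countable_ideal_closure_ideal[OF D(1)])
  have "\<exists>E. \<forall>n. E n \<in> closure_ideal D I \<and> (A \<subseteq> (\<Union>n :: nat. closure (E n)))"
    if A: "A \<in> \<A>" for A
  proof -
    obtain N where N: "\<And>n. closed (N n)" "\<And>n. N n \<in> I" "A \<subseteq> (\<Union>n :: nat. N n)"
      using cover[OF A] by blast
    have "\<forall>n. \<exists>E. E \<in> closure_ideal D I \<and> N n \<subseteq> closure E"
      using closed_dense_subset[OF N(1,2) D] by blast
    then obtain E where E: "\<forall>n. E n \<in> closure_ideal D I \<and> N n \<subseteq> closure (E n)"
      by (auto simp only: choice_iff)
    have "A \<subseteq> (\<Union>n. closure (E n))"
    proof
      fix y assume "y \<in> A"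
      then obtain n where "y \<in> N n" using N(3) by auto
      then show "y \<in> (\<Union>n. closure (E n))" using E by auto
    qed
    then show ?thesis using E by (intro exI[of _ E]) simp
  qed
  then have "\<forall>A\<in>\<A>. \<exists>E. \<forall>n. E n \<in> closure_ideal D I \<and> (A \<subseteq> (\<Union>n :: nat. closure (E n)))"
    by (rule ballI)
  then obtain E where "\<forall>A\<in>\<A>. \<forall>n. E A n \<in> closure_ideal D I \<and> (A \<subseteq> (\<Union>n :: nat. closure (E A n)))"
    by (auto simp only: bchoice_iff)
  then have E: "\<And>A n. A \<in> \<A> \<Longrightarrow> E A n \<in> closure_ideal D I"
    "\<And>A. A \<in> \<A> \<Longrightarrow> A \<subseteq> (\<Union>n :: nat. closure (E A n))"
    by simp_all
  define F where "F = (\<lambda>A. J.rank (E A)) ` \<A>"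
  have "\<not> (\<exists>g\<in>ideal_to_one D (closure_ideal D I). \<forall>f\<in>F. ideal_le D (closure_ideal D I) g f)"
  proof
    assume "\<exists>g\<in>ideal_to_one D (closure_ideal D I). \<forall>f\<in>F. ideal_le D (closure_ideal D I) g f"
    then obtain g where g: "g \<in> ideal_to_one D (closure_ideal D I)"
      and gF: "\<And>A. A \<in> \<A> \<Longrightarrow> ideal_le D (closure_ideal D I) g (J.rank (E A))"
      unfolding F_def by auto
    define C where "C n = closure {x \<in> D. g x \<le> n}" for n
    define G where "G = {y. \<exists>z\<in>(\<Union>n. C n). finite {i. y i \<noteq> z i}}"
    have "C n \<in> I" for n
      using J.ideal_to_one_le[OF g, of n] by (simp add: C_def closure_ideal_def)
    then have GI: "G \<in> I" unfolding G_def by (intro tail UN)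
    have "A \<subseteq> G" if A: "A \<in> \<A>" for A
    proof
      fix y assume y: "y \<in> A"
      define B where "B = {x \<in> D. g x > J.rank (E A) x}"
      have "closure B \<in> I" using gF[OF A] by (simp add: ideal_le_def closure_ideal_def B_def)
      then have "\<not> cyl y 0 \<subseteq> closure B" by (rule no_cyl)
      then obtain z l where l: "cyl z l \<inter> B = {}" unfolding subset_iff closure_cyl_iff by blast
      define y' where "y' = splice l z y"
      have dif: "{i. y' i \<noteq> y i} \<subseteq> {..<l}" by (auto simp: y'_def splice_def)
      then have "y' \<in> A" using tail_inv[OF A y] finite_subset by blast
      then obtain n where n: "y' \<in> closure (E A n)" using E(2)[OF A] by auto
      have "E A n \<subseteq> {x \<in> D. g x \<le> n} \<union> B"
      proof
        fix x assume x: "x \<in> E A n"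
        then have xD: "x \<in> D" using E(1)[OF A, of n] by (auto simp: closure_ideal_def)
        then have "J.rank (E A) x \<le> n" using x by (rule J.rank_le)
        then show "x \<in> {x \<in> D. g x \<le> n} \<union> B" using xD unfolding B_def by auto
      qed
      from closure_mono[OF this] have "y' \<in> C n \<union> closure B"
        using n unfolding C_def closure_Un by auto
      moreover have "y' \<notin> closure B"
      proof -
        have "cyl y' l = cyl z l" unfolding y'_def by (intro cyl_eqI splice_in_cyl)
        then show ?thesis using l unfolding closure_cyl_iff by blast
      qed
      ultimately have "y' \<in> C n" by simp
      moreover have "finite {i. y i \<noteq> y' i}"
        by (rule finite_subset[of _ "{..<l}"]) (use dif in auto)
      ultimately show "y \<in> G" unfolding G_def by auto
    qed
    then have "\<Union>\<A> \<subseteq> G" by blast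
    then show False using large subset[OF GI] by blast
  qed
  moreover have "F \<subseteq> ideal_to_one D (closure_ideal D I)"
    unfolding F_def using J.rank_mem[OF E(1)] by auto
  ultimately have "unbounded_below D (closure_ideal D I) F"
    by (simp add: unbounded_below_def)
  moreover have "|F| \<le>o |\<A>|" unfolding F_def by (rule card_of_image)
  ultimately show ?thesis by blast
qed

lemma ex_unbounded_below_le_card:
  assumes D: "countable D" "closure D = UNIV" and X: "X \<notin> I"
  shows "\<exists>F. unbounded_below D (closure_ideal D I) F \<and> |F| \<le>o |X|"
proof -
  define S where "S x = {y. finite {i. y i \<noteq> x i}}" for x :: cantor
  have selfS: "x \<in> S x" for x by (simp add: S_def)
  have "\<exists>F. unbounded_below D (closure_ideal D I) F \<and> |F| \<le>o |S ` X|"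
  proof (rule ex_unbounded_below[OF D])
    fix A assume "A \<in> S ` X"
    then obtain x where x: "A = S x" by blast
    have "closed {from_nat_into A n}" for n by (rule finite_closed_cantor) simp
    moreover have "A \<subseteq> (\<Union>n. {from_nat_into A n})"
    proof -
      have "countable A" unfolding x S_def by (rule countable_tail)
      then have "range (from_nat_into A) = A"
        by (intro range_from_nat_into) (use selfS x in auto)
      then show ?thesis by (simp add: UNION_singleton_eq_range)
    qed
    ultimately show "\<exists>N. (\<forall>n. closed (N n) \<and> N n \<in> I) \<and> A \<subseteq> (\<Union>n :: nat. N n)"
      by (intro exI[of _ "\<lambda>n. {from_nat_into A n}"]) (simp add: singleton)
    fix y z assume y: "y \<in> A" and f: "finite {i. z i \<noteq> y i}"
    have "finite {i. y i \<noteq> x i}" using y x by (simp add: S_def)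
    with f have "finite ({i. z i \<noteq> y i} \<union> {i. y i \<noteq> x i})" by simp
    then have "finite {i. z i \<noteq> x i}" by (rule finite_subset[rotated]) auto
    then show "z \<in> A" using x by (simp add: S_def)
  next
    have "X \<subseteq> \<Union>(S ` X)" using selfS by auto
    then show "\<Union>(S ` X) \<notin> I" using X subset by blast
  qed
  then obtain F where F: "unbounded_below D (closure_ideal D I) F" "|F| \<le>o |S ` X|" by blast
  from F(2) card_of_image have "|F| \<le>o |X|" by (rule ordLeq_transitive)
  with F(1) show ?thesis by blast
qed

end

interpretation meager: cantor_ideal meager_sets
proof
  show "A \<in> meager_sets \<Longrightarrow> B \<subseteq> A \<Longrightarrow> B \<in> meager_sets" for A B by (rule meager_subset)
  show "(\<And>n :: nat. E n \<in> meager_sets) \<Longrightarrow> (\<Union>n. E n) \<in> meager_sets" for E by (rule meager_UN)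
  have "nowhere_dense {x}" for x :: cantor
    unfolding nowhere_dense_iff
  proof (intro allI)
    fix y l
    have "splice l y (\<lambda>i. \<not> x i) \<in> cyl y l" by simp
    moreover have "cyl (splice l y (\<lambda>i. \<not> x i)) (Suc l) \<inter> {x} = {}"
      by (auto simp: cyl_def splice_def)
    ultimately show "\<exists>z\<in>cyl y l. \<exists>k. cyl z k \<inter> {x} = {}" by blast
  qed
  then show "{x} \<in> meager_sets" for x
    unfolding meager_sets_def by (auto intro!: exI[of _ "{{x}}"])
  show "\<not> cyl x l \<subseteq> A" if A: "A \<in> meager_sets" for A x l
  proof -
    obtain y a where "strict_mono a" "A \<subseteq> blockset y a" using meager_blockset[OF A] by blast
    then show ?thesis using blockset_no_cyl[of a x l y] by blast
  qed
  show "{y. \<exists>z\<in>A. finite {i. y i \<noteq> z i}} \<in> meager_sets" if A: "A \<in> meager_sets" for A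
  proof -
    obtain x a where a: "strict_mono a" "A \<subseteq> blockset x a" using meager_blockset[OF A] by blast
    have "{y. \<exists>z\<in>A. finite {i. y i \<noteq> z i}} \<subseteq> blockset x a"
      using blockset_tail[OF a(1)] a(2) by blast
    then show ?thesis using meager_subset[OF blockset_meager[OF a(1)]] by blast
  qed
qed

lemma uncountable_cantor: "\<not> countable (UNIV :: cantor set)"
proof
  assume "countable (UNIV :: cantor set)"
  then have f: "range (from_nat_into (UNIV :: cantor set)) = UNIV"
    by (intro range_from_nat_into) auto
  define e where "e i = {j. from_nat_into (UNIV :: cantor set) i j}" for i
  have "S \<in> range e" for S
  proof -
    have "(\<lambda>j. j \<in> S) \<in> range (from_nat_into (UNIV :: cantor set))" by (simp only: f UNIV_I)
    then obtain i where "(\<lambda>j. j \<in> S) = from_nat_into (UNIV :: cantor set) i" by (rule rangeE)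
    then have "S = e i" unfolding e_def by (metis Collect_mem_eq)
    then show ?thesis by simp
  qed
  then have "e ` UNIV = Pow UNIV" by auto
  then show False using Cantors_theorem by blast
qed

interpretation ctbl: cantor_ideal countable_sets
proof
  show "A \<in> countable_sets \<Longrightarrow> B \<subseteq> A \<Longrightarrow> B \<in> countable_sets" for A B
    unfolding countable_sets_def using countable_subset by blast
  show "(\<And>n :: nat. E n \<in> countable_sets) \<Longrightarrow> (\<Union>n. E n) \<in> countable_sets" for E
    unfolding countable_sets_def by simp
  show "{x} \<in> countable_sets" for x by (simp add: countable_sets_def)
  show "{y. \<exists>z\<in>A. finite {i. y i \<noteq> z i}} \<in> countable_sets" if "A \<in> countable_sets" for A
  proof -
    have "{y. \<exists>z\<in>A. finite {i. y i \<noteq> z i}} = (\<Union>z\<in>A. {y. finite {i. y i \<noteq> z i}})" by blast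
    then show ?thesis using that countable_tail by (simp add: countable_sets_def)
  qed
  show "\<not> cyl x l \<subseteq> A" if "A \<in> countable_sets" for A x l
  proof
    assume "cyl x l \<subseteq> A"
    then have c: "countable (cyl x l)"
      using that countable_subset unfolding countable_sets_def by blast
    have "(UNIV :: cantor set) = (\<lambda>y i. y (i + l)) ` cyl x l"
    proof -
      have "y = (\<lambda>i. splice l x (\<lambda>i. y (i - l)) (i + l))" for y by (simp add: splice_def)
      then show ?thesis using splice_in_cyl by blast
    qed
    then have "countable (UNIV :: cantor set)"
      using countable_image[OF c, of "\<lambda>y i. y (i + l)"] by metis
    then show False using uncountable_cantor by blast
  qed
qed

subsection \<open>CTBL and NWD\<close>

lemma b_CTBL:
  assumes D: "countable D" "closure D = UNIV"
  shows "b_ideal D (CTBL D) =o cardSuc natLeq"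
proof -
  define K where "K = Field (cardSuc natLeq)"
  have K: "|K| =o cardSuc natLeq"
    unfolding K_def by (rule card_of_Field_ordIso[OF cardSuc_Card_order[OF natLeq_Card_order]])
  have "cardSuc natLeq \<le>o |UNIV :: cantor set|"
    by (intro cardSuc_least natLeq_Card_order card_of_Card_order natLeq_less_uncountable uncountable_cantor)
  with K have "|K| \<le>o |UNIV :: cantor set|" by (rule ordIso_ordLeq_trans)
  then obtain h :: "nat set \<Rightarrow> cantor" where h: "inj_on h K"
    unfolding card_of_ordLeq[symmetric] by blast
  have "h ` K \<notin> countable_sets"
  proof
    assume "h ` K \<in> countable_sets"
    then have "countable (h ` K)" by (simp add: countable_sets_def)
    then have "countable K" using h by (rule countable_image_inj_on)
    then obtain e :: "nat set \<Rightarrow> nat" where "inj_on e K" unfolding countable_def by blast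
    then have "|K| \<le>o |UNIV :: nat set|" unfolding card_of_ordLeq[symmetric] by blast
    then have "cardSuc natLeq \<le>o natLeq"
      using K card_of_nat by (meson ordIso_ordLeq_trans ordIso_symmetric ordLeq_ordIso_trans)
    then show False using cardSuc_greater[OF natLeq_Card_order] not_ordLess_ordLeq by blast
  qed
  from ctbl.ex_unbounded_below_le_card[OF D this]
  obtain F where F: "unbounded_below D (CTBL D) F" "|F| \<le>o |h ` K|" unfolding CTBL_def by blast
  have "|F| \<le>o |K|" using F(2) card_of_image by (rule ordLeq_transitive)
  then have "b_ideal D (CTBL D) \<le>o cardSuc natLeq"
    using ordLeq_transitive[OF b_ideal_le[OF F(1)]] K by (blast intro: ordLeq_ordIso_trans)
  moreover have "cardSuc natLeq \<le>o b_ideal D (CTBL D)"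
    using F(1) unfolding CTBL_def
    by (rule countable_ideal.cardSuc_le_b_ideal[OF ctbl.countable_ideal_closure_ideal[OF D(1)]])
  ultimately show ?thesis by (simp add: ordIso_iff_ordLeq)
qed

lemma add_meager_attained:
  "\<exists>\<A>\<subseteq>meager_sets. \<Union>\<A> \<notin> meager_sets \<and> add_ideal meager_sets = |\<A>|"
proof -
  have "UNIV \<notin> meager_sets" using meager.no_cyl by blast
  moreover have "\<Union>(range (\<lambda>x. {x})) = (UNIV :: cantor set)" by auto
  ultimately have "range (\<lambda>x. {x}) \<in> {\<A>. \<A> \<subseteq> meager_sets \<and> \<Union>\<A> \<notin> meager_sets}"
    using meager.singleton by auto
  then have "{\<A>. \<A> \<subseteq> meager_sets \<and> \<Union>\<A> \<notin> meager_sets} \<noteq> {}" by blast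
  from least_card_attained[OF this] show ?thesis unfolding add_ideal_def by blast
qed

lemma add_meager_le: "\<A> \<subseteq> meager_sets \<Longrightarrow> \<Union>\<A> \<notin> meager_sets \<Longrightarrow> add_ideal meager_sets \<le>o |\<A>|"
  unfolding add_ideal_def by (rule least_card_le_member) auto

lemma unbounded_below_NWD_le_add:
  assumes D: "countable D" "closure D = UNIV"
  shows "\<exists>F. unbounded_below D (NWD D) F \<and> |F| \<le>o add_ideal meager_sets"
proof -
  obtain \<A> where A: "\<A> \<subseteq> meager_sets" "\<Union>\<A> \<notin> meager_sets" "add_ideal meager_sets = |\<A>|"
    using add_meager_attained by blast
  have "\<forall>A\<in>\<A>. \<exists>p. strict_mono (snd p) \<and> A \<subseteq> blockset (fst p) (snd p)"
    using meager_blockset A(1) by fastforce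
  then obtain p where p: "\<forall>A\<in>\<A>. strict_mono (snd (p A)) \<and> A \<subseteq> blockset (fst (p A)) (snd (p A))"
    by (auto simp only: bchoice_iff)
  define B where "B A = blockset (fst (p A)) (snd (p A))" for A
  have "\<exists>F. unbounded_below D (closure_ideal D meager_sets) F \<and> |F| \<le>o |B ` \<A>|"
  proof (rule meager.ex_unbounded_below[OF D])
    fix C assume "C \<in> B ` \<A>"
    then obtain A where A: "A \<in> \<A>" "C = B A" by blast
    have sm: "strict_mono (snd (p A))" using p A(1) by blast
    have "misses (fst (p A)) (snd (p A)) n \<in> meager_sets" for n
      using blockset_meager[OF sm] by (rule meager.subset) (auto simp: blockset_def)
    then show "\<exists>N. (\<forall>n. closed (N n) \<and> N n \<in> meager_sets) \<and> C \<subseteq> (\<Union>n :: nat. N n)"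
      unfolding A(2) B_def blockset_def
      by (intro exI[of _ "misses (fst (p A)) (snd (p A))"]) (simp add: closed_misses)
    show "y \<in> C \<Longrightarrow> finite {i. z i \<noteq> y i} \<Longrightarrow> z \<in> C" for y z
      unfolding A(2) B_def by (rule blockset_tail[OF sm])
  next
    have "\<Union>\<A> \<subseteq> \<Union>(B ` \<A>)" using p unfolding B_def by blast
    then show "\<Union>(B ` \<A>) \<notin> meager_sets" using A(2) meager.subset by blast
  qed
  then obtain F where F: "unbounded_below D (NWD D) F" "|F| \<le>o |B ` \<A>|" unfolding NWD_def by blast
  have "|B ` \<A>| \<le>o |\<A>|" by (rule card_of_image)
  with F(2) have "|F| \<le>o |\<A>|" by (rule ordLeq_transitive)
  then show ?thesis using F(1) A(3) by auto
qed

lemma add_le_unbounded_below_NWD: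
  assumes D: "countable D" and F: "unbounded_below D (NWD D) F"
  shows "add_ideal meager_sets \<le>o |F|"
proof -
  interpret J: countable_ideal D "NWD D"
    unfolding NWD_def by (rule meager.countable_ideal_closure_ideal[OF D])
  have F1: "F \<subseteq> ideal_to_one D (NWD D)" using F by (simp add: unbounded_below_def)
  define E where "E f n = closure {x \<in> D. f x \<le> n}" for f :: "cantor \<Rightarrow> nat" and n
  have nd: "nowhere_dense (E f n)" if "f \<in> F" for f n
  proof -
    have "f \<in> ideal_to_one D (NWD D)" using F1 that by blast
    from J.ideal_to_one_le[OF this, of n] have "E f n \<in> meager_sets"
      by (simp add: NWD_def closure_ideal_def E_def)
    then show ?thesis
      using meager.no_cyl[of "E f n"] by (simp add: E_def nowhere_dense_closed_iff)
  qed
  have "\<exists>p. strict_mono (snd p) \<and> (\<forall>k y. (\<forall>i. snd p k \<le> i \<and> i < snd p (Suc k) \<longrightarrow> y i = fst p i) \<longrightarrow> y \<notin> E f (snd p k))"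
    if f: "f \<in> F" for f
  proof -
    obtain x a where "strict_mono a \<and> (\<forall>k y. (\<forall>i. a k \<le> i \<and> i < a (Suc k) \<longrightarrow> y i = x i) \<longrightarrow> y \<notin> E f (a k))"
      using nowhere_dense_blocks[of "E f"] nd[OF f] by blast
    then show ?thesis by (intro exI[of _ "(x, a)"]) simp
  qed
  then have "\<forall>f\<in>F. \<exists>p. strict_mono (snd p) \<and> (\<forall>k y. (\<forall>i. snd p k \<le> i \<and> i < snd p (Suc k) \<longrightarrow> y i = fst p i) \<longrightarrow> y \<notin> E f (snd p k))"
    by (rule ballI)
  then obtain p where p: "\<forall>f\<in>F. strict_mono (snd (p f)) \<and> (\<forall>k y. (\<forall>i. snd (p f) k \<le> i \<and> i < snd (p f) (Suc k) \<longrightarrow> y i = fst (p f) i) \<longrightarrow> y \<notin> E f (snd (p f) k))"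
    by (auto simp only: bchoice_iff)
  define \<A> where "\<A> = (\<lambda>f. blockset (fst (p f)) (snd (p f))) ` F"
  have "\<A> \<subseteq> meager_sets" using p blockset_meager unfolding \<A>_def by blast
  moreover have "\<Union>\<A> \<notin> meager_sets"
  proof
    assume "\<Union>\<A> \<in> meager_sets"
    then obtain x b where b: "strict_mono b" "\<Union>\<A> \<subseteq> blockset x b" using meager_blockset by blast
    define C where "C n = misses x b n \<inter> D" for n
    have C: "C n \<in> NWD D" for n
    proof -
      have "misses x b n \<in> meager_sets"
        using blockset_meager[OF b(1), of x] by (rule meager.subset) (auto simp: blockset_def)
      moreover have "closure (C n) \<subseteq> misses x b n"
        by (rule closure_minimal[OF _ closed_misses]) (auto simp: C_def)
      ultimately have "closure (C n) \<in> meager_sets" by (rule meager.subset)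
      then show ?thesis unfolding NWD_def closure_ideal_def C_def by simp
    qed
    have "\<not> unbounded_below D (NWD D) F"
    proof (rule J.lower_bound[OF C F1])
      fix f assume f: "f \<in> F"
      define x' where "x' = fst (p f)"
      define a where "a = snd (p f)"
      have a: "strict_mono a" using p f unfolding a_def by blast
      have av: "y \<notin> E f (a k)" if "\<And>i. a k \<le> i \<Longrightarrow> i < a (Suc k) \<Longrightarrow> y i = x' i" for k y
        using p f that unfolding a_def x'_def by blast
      have "blockset x' a \<subseteq> blockset x b"
        using b(2) f unfolding \<A>_def a_def x'_def by blast
      from captures_if_subset[OF this a b(1)] obtain M where
        M: "\<And>m. m \<ge> M \<Longrightarrow> \<exists>k. b m \<le> a k \<and> a (Suc k) \<le> b (Suc m) \<and>
           (\<forall>i. a k \<le> i \<and> i < a (Suc k) \<longrightarrow> x i = x' i)"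
        unfolding captures_def by blast
      have "{x \<in> D. f x \<le> n} \<subseteq> C n" if n: "n \<ge> M" for n
      proof
        fix y assume y: "y \<in> {x \<in> D. f x \<le> n}"
        have "y \<in> misses x b n"
          unfolding misses_def
        proof (intro CollectI allI impI, rule ccontr)
          fix m assume m: "n \<le> m" "\<nexists>i. b m \<le> i \<and> i < b (Suc m) \<and> y i \<noteq> x i"
          obtain k where k: "b m \<le> a k" "a (Suc k) \<le> b (Suc m)"
            "\<And>i. a k \<le> i \<Longrightarrow> i < a (Suc k) \<Longrightarrow> x i = x' i"
            using M[of m] m(1) n by auto
          have "y i = x' i" if "a k \<le> i" "i < a (Suc k)" for i
            using m(2) k that by (metis less_le_trans order_trans)
          then have "y \<notin> E f (a k)" by (rule av)
          moreover have "n \<le> a k"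
            using m(1) k(1) strict_mono_imp_increasing[OF b(1), of m] by simp
          then have "y \<in> {x \<in> D. f x \<le> a k}" using y by auto
          then have "y \<in> E f (a k)" unfolding E_def by (rule closure_subset[THEN subsetD])
          ultimately show False by blast
        qed
        then show "y \<in> C n" using y by (simp add: C_def)
      qed
      then show "\<exists>N. \<forall>n\<ge>N. {x \<in> D. f x \<le> n} \<subseteq> C n" by blast
    qed
    then show False using F by blast
  qed
  ultimately have "add_ideal meager_sets \<le>o |\<A>|" by (rule add_meager_le)
  moreover have "|\<A>| \<le>o |F|" unfolding \<A>_def by (rule card_of_image)
  ultimately show ?thesis by (rule ordLeq_transitive)
qed

lemma b_NWD:
  assumes D: "countable D" "closure D = UNIV"
  shows "b_ideal D (NWD D) =o add_ideal meager_sets"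
proof -
  obtain F where F: "unbounded_below D (NWD D) F" "|F| \<le>o add_ideal meager_sets"
    using unbounded_below_NWD_le_add[OF D] by blast
  obtain F' where F': "unbounded_below D (NWD D) F'" "b_ideal D (NWD D) = |F'|"
    using b_ideal_attained[OF F(1)] by blast
  have "b_ideal D (NWD D) \<le>o add_ideal meager_sets"
    using b_ideal_le[OF F(1)] F(2) by (rule ordLeq_transitive)
  moreover have "add_ideal meager_sets \<le>o b_ideal D (NWD D)"
    unfolding F'(2) by (rule add_le_unbounded_below_NWD[OF D(1) F'(1)])
  ultimately show ?thesis by (simp add: ordIso_iff_ordLeq)
qed

subsection \<open>Closed null sets\<close>

interpretation cantor: prob_space cantor_measure
  by (rule prob_space_cantor_measure)

lemma space_cantor_measure [simp]: "space cantor_measure = UNIV"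
proof -
  have "space cantor_measure = space borel"
    using sets_cantor_measure by (rule sets_eq_imp_space_eq)
  then show ?thesis by simp
qed

lemma closed_cantor_measurable: "closed C \<Longrightarrow> C \<in> sets cantor_measure"
  by (simp add: sets_cantor_measure)

lemma open_cantor_measurable: "open C \<Longrightarrow> C \<in> sets cantor_measure"
  by (simp add: sets_cantor_measure)

lemma emeasure_bool_uniform:
  "emeasure (uniform_count_measure (UNIV :: bool set)) {b. P (b \<noteq> c)} =
    emeasure (uniform_count_measure UNIV) {b. P b}"
proof -
  have "bij_betw (\<lambda>b. b \<noteq> c) {b. P (b \<noteq> c)} {b. P b}"
    by (rule bij_betwI[where g = "\<lambda>b. b \<noteq> c"]; cases c) auto
  then show ?thesis by (simp add: emeasure_uniform_count_measure bij_betw_same_card)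
qed

lemma measure_agree:
  assumes "finite S"
  shows "measure cantor_measure {y. \<forall>i\<in>S. y i = w i} = (1 / 2) ^ card S"
proof -
  have eq: "{y. \<forall>i\<in>S. y i = w i} =
      prod_emb UNIV (\<lambda>_. uniform_count_measure (UNIV :: bool set)) S (\<Pi>\<^sub>E i\<in>S. {w i})"
    by (auto simp: prod_emb_def space_PiM space_uniform_count_measure Pi_iff restrict_def PiE_iff)
  have "emeasure cantor_measure {y. \<forall>i\<in>S. y i = w i} =
      (\<Prod>i\<in>S. emeasure (uniform_count_measure (UNIV :: bool set)) {w i})"
    unfolding eq cantor_measure_def
    by (rule emeasure_PiM_emb)
      (use assms in \<open>auto intro!: prob_space_uniform_count_measure simp: sets_uniform_count_measure\<close>)
  also have "\<dots> = (\<Prod>i\<in>S. ennreal (1 / 2))"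
    by (simp add: emeasure_uniform_count_measure)
  also have "\<dots> = ennreal ((1 / 2) ^ card S)"
    unfolding prod_constant by (rule ennreal_power) simp
  finally show ?thesis by (simp add: measure_def)
qed

lemma measurable_flip: "(\<lambda>y i. y i \<noteq> q i) \<in> measurable cantor_measure cantor_measure"
  unfolding cantor_measure_def
proof (rule measurable_PiM_single')
  let ?U = "uniform_count_measure (UNIV :: bool set)"
  fix i :: nat
  have "(\<lambda>y. y i) \<in> measurable (PiM UNIV (\<lambda>_. ?U)) ?U"
    by (rule measurable_component_singleton) simp
  moreover have "(\<lambda>b. b \<noteq> q i) \<in> measurable ?U ?U"
    by (auto simp: measurable_def space_uniform_count_measure sets_uniform_count_measure)
  ultimately show "(\<lambda>y. y i \<noteq> q i) \<in> measurable (PiM UNIV (\<lambda>_. ?U)) ?U"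
    by (rule measurable_compose)
qed (auto simp: space_uniform_count_measure)

lemma distr_flip: "distr cantor_measure cantor_measure (\<lambda>y i. y i \<noteq> q i) = cantor_measure"
proof -
  let ?U = "uniform_count_measure (UNIV :: bool set)"
  interpret P: product_prob_space "\<lambda>_ :: nat. ?U" UNIV
    by (intro product_prob_spaceI prob_space_uniform_count_measure) auto
  have "distr cantor_measure cantor_measure (\<lambda>y i. y i \<noteq> q i) = PiM UNIV (\<lambda>_. ?U)"
  proof (rule P.PiM_eq)
    show "sets (distr cantor_measure cantor_measure (\<lambda>y i. y i \<noteq> q i)) = sets (PiM UNIV (\<lambda>_. ?U))"
      by (simp add: cantor_measure_def)
    fix J :: "nat set" and F :: "nat \<Rightarrow> bool set"
    assume J: "finite J" "J \<subseteq> UNIV" and F: "\<And>j. j \<in> J \<Longrightarrow> F j \<in> sets ?U"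
    have emb: "prod_emb UNIV (\<lambda>_. ?U) J (\<Pi>\<^sub>E j\<in>J. G j) = {y. \<forall>j\<in>J. y j \<in> G j}" for G
      by (auto simp: prod_emb_def space_PiM space_uniform_count_measure Pi_iff restrict_def PiE_iff)
    have "prod_emb UNIV (\<lambda>_. ?U) J (\<Pi>\<^sub>E j\<in>J. F j) \<in> sets cantor_measure"
      unfolding cantor_measure_def using J F by (intro sets_PiM_I) auto
    then have "emeasure (distr cantor_measure cantor_measure (\<lambda>y i. y i \<noteq> q i))
        (prod_emb UNIV (\<lambda>_. ?U) J (\<Pi>\<^sub>E j\<in>J. F j)) =
      emeasure cantor_measure ((\<lambda>y i. y i \<noteq> q i) -` prod_emb UNIV (\<lambda>_. ?U) J (\<Pi>\<^sub>E j\<in>J. F j))"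
      by (subst emeasure_distr[OF measurable_flip]) simp_all
    also have "(\<lambda>y i. y i \<noteq> q i) -` prod_emb UNIV (\<lambda>_. ?U) J (\<Pi>\<^sub>E j\<in>J. F j) =
        prod_emb UNIV (\<lambda>_. ?U) J (\<Pi>\<^sub>E j\<in>J. {b. (b \<noteq> q j) \<in> F j})"
      unfolding emb by auto
    also have "emeasure cantor_measure \<dots> = (\<Prod>j\<in>J. emeasure ?U {b. (b \<noteq> q j) \<in> F j})"
      unfolding cantor_measure_def using J
      by (intro P.emeasure_PiM_emb) (auto simp: sets_uniform_count_measure)
    also have "\<dots> = (\<Prod>j\<in>J. emeasure ?U (F j))"
      using emeasure_bool_uniform[where P = "\<lambda>b. b \<in> F j" and c = "q j" for j]
      by (intro prod.cong) simp_all
    finally show "emeasure (distr cantor_measure cantor_measure (\<lambda>y i. y i \<noteq> q i))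
        (prod_emb UNIV (\<lambda>_. ?U) J (\<Pi>\<^sub>E j\<in>J. F j)) = (\<Prod>j\<in>J. emeasure ?U (F j))" .
  qed
  then show ?thesis by (simp only: cantor_measure_def)
qed

definition nbhd :: "cantor set \<Rightarrow> nat \<Rightarrow> cantor set" where
  "nbhd C l = (\<Union>x\<in>C. cyl x l)"

lemma open_nbhd: "open (nbhd C l)"
  unfolding nbhd_def by (intro open_UN ballI open_cyl)

lemma subset_nbhd: "C \<subseteq> nbhd C l"
  unfolding nbhd_def using cyl_self by blast

lemma nbhd_cyl: "y \<in> nbhd C l \<Longrightarrow> z \<in> cyl y l \<Longrightarrow> z \<in> nbhd C l"
  unfolding nbhd_def using cyl_eqI by blast

lemma null_nbhd:
  assumes "closed C" "C \<in> null_sets cantor_measure" "e > 0"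
  shows "\<exists>l. measure cantor_measure (nbhd C l) < e"
proof -
  have "(\<Inter>l. nbhd C l) = C"
  proof
    show "(\<Inter>l. nbhd C l) \<subseteq> C"
    proof
      fix y assume y: "y \<in> (\<Inter>l. nbhd C l)"
      have "y \<in> closure C"
        unfolding closure_cyl_iff
      proof
        fix l
        obtain x where "x \<in> C" "y \<in> cyl x l" using y by (auto simp: nbhd_def)
        then show "cyl y l \<inter> C \<noteq> {}" using cyl_eqI[of y x l] cyl_self by blast
      qed
      then show "y \<in> C" using assms(1) by simp
    qed
  qed (use subset_nbhd in blast)
  moreover have "(\<lambda>l. measure cantor_measure (nbhd C l)) \<longlonglongrightarrow> measure cantor_measure (\<Inter>l. nbhd C l)"
  proof (rule cantor.finite_Lim_measure_decseq)
    show "range (nbhd C) \<subseteq> sets cantor_measure"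
      using open_cantor_measurable[OF open_nbhd] by auto
    show "decseq (nbhd C)"
      unfolding decseq_def nbhd_def using cyl_antimono by blast
  qed
  moreover have "measure cantor_measure C = 0"
    using assms(2) by (simp add: measure_def null_setsD1)
  ultimately have "(\<lambda>l. measure cantor_measure (nbhd C l)) \<longlonglongrightarrow> 0" by simp
  then have "\<forall>\<^sub>F l in sequentially. measure cantor_measure (nbhd C l) < e"
    using assms(3) by (rule order_tendstoD)
  then show ?thesis by (auto simp: eventually_sequentially)
qed

lemma closed_nullI:
  assumes "closed C" "\<And>n. measure cantor_measure C \<le> (1 / 2) ^ n"
  shows "C \<in> null_sets cantor_measure"
proof -
  have "(\<lambda>n. (1 / 2 :: real) ^ n) \<longlonglongrightarrow> 0" by (rule LIMSEQ_power_zero) simp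
  then have "measure cantor_measure C \<le> 0"
    by (rule LIMSEQ_le_const) (use assms(2) in auto)
  then have "measure cantor_measure C = 0" using measure_nonneg antisym by blast
  then have "emeasure cantor_measure C = 0" by (simp add: cantor.emeasure_eq_measure)
  then show ?thesis using closed_cantor_measurable[OF assms(1)] by (rule null_setsI)
qed

lemma measure_cyl: "measure cantor_measure (cyl x l) = (1 / 2) ^ l"
proof -
  have "cyl x l = {y. \<forall>i\<in>{..<l}. y i = x i}" by (auto simp: cyl_def)
  then show ?thesis using measure_agree[of "{..<l}" x] by simp
qed

lemma sigma_closed_nullI: "closed N \<Longrightarrow> N \<in> null_sets cantor_measure \<Longrightarrow> N \<in> sigma_closed_null_sets"
  unfolding sigma_closed_null_sets_def by (auto intro!: exI[of _ "{N}"] compact_cantor)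

lemma closed_if_compact_cantor:
  assumes "compact (K :: cantor set)"
  shows "closed K"
  unfolding closed_cyl_iff
proof (intro allI impI)
  fix x assume x: "x \<notin> K"
  have "y = x" if "\<And>l. y \<in> cyl x l" for y
    using that by (auto simp: cyl_def)
  then have "K \<subseteq> (\<Union>l\<in>UNIV. - cyl x l)" using x by auto
  moreover have "open (- cyl x l)" for l by (simp add: open_Compl)
  ultimately obtain S where S: "finite S" "K \<subseteq> (\<Union>l\<in>S. - cyl x l)"
    using compactE_image[OF assms, of UNIV "\<lambda>l. - cyl x l"] by metis
  obtain L where L: "\<forall>l\<in>S. l \<le> L" using S(1) finite_nat_set_iff_bounded_le by blast
  have "cyl x L \<inter> K = {}" using S(2) L cyl_antimono by blast
  then show "\<exists>l. cyl x l \<inter> K = {}" ..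
qed

lemma sigma_closed_null_cover:
  assumes "A \<in> sigma_closed_null_sets"
  shows "\<exists>C. (\<forall>n. closed (C n) \<and> C n \<in> null_sets cantor_measure) \<and> A \<subseteq> (\<Union>n :: nat. C n)"
proof -
  obtain K where K: "countable K" "\<forall>N\<in>K. compact N \<and> N \<in> null_sets cantor_measure" "A \<subseteq> \<Union>K"
    using assms unfolding sigma_closed_null_sets_def by auto
  define C where "C = from_nat_into (insert {} K)"
  have C: "range C = insert {} K"
    unfolding C_def using K(1) by (intro range_from_nat_into) auto
  have "closed (C n) \<and> C n \<in> null_sets cantor_measure" for n
  proof -
    have "C n \<in> insert {} K" using C by blast
    then show ?thesis using K(2) closed_if_compact_cantor by auto
  qed
  moreover have "A \<subseteq> \<Union>(range C)" using K(3) unfolding C by auto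
  ultimately show ?thesis by (intro exI[of _ C]) simp
qed

interpretation null: cantor_ideal sigma_closed_null_sets
proof
  show null_subset: "A \<in> sigma_closed_null_sets \<Longrightarrow> B \<subseteq> A \<Longrightarrow> B \<in> sigma_closed_null_sets" for A B
    unfolding sigma_closed_null_sets_def by fastforce
  show null_UN: "(\<Union>n. E n) \<in> sigma_closed_null_sets" if E: "\<And>n :: nat. E n \<in> sigma_closed_null_sets" for E
  proof -
    have "\<forall>n. \<exists>K. countable K \<and> (\<forall>N\<in>K. compact N \<and> N \<in> null_sets cantor_measure) \<and> E n \<subseteq> \<Union>K"
      using E unfolding sigma_closed_null_sets_def by simp
    then obtain K where K: "\<forall>n. countable (K n) \<and>
        (\<forall>N\<in>K n. compact N \<and> N \<in> null_sets cantor_measure) \<and> E n \<subseteq> \<Union>(K n)"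
      by (auto simp only: choice_iff)
    have "countable (\<Union>n. K n)" using K by auto
    moreover have "\<forall>N\<in>(\<Union>n. K n). compact N \<and> N \<in> null_sets cantor_measure" using K by blast
    moreover have "(\<Union>n. E n) \<subseteq> \<Union>(\<Union>n. K n)" using K by blast
    ultimately show ?thesis
      unfolding sigma_closed_null_sets_def by (intro CollectI exI[of _ "\<Union>n. K n"] conjI)
  qed
  show "{x} \<in> sigma_closed_null_sets" for x
  proof (intro sigma_closed_nullI closed_nullI)
    show "measure cantor_measure {x} \<le> (1 / 2) ^ n" for n
      using cantor.finite_measure_mono[of "{x}" "cyl x n"] open_cantor_measurable[OF open_cyl, of x n]
      by (simp add: measure_cyl)
  qed (simp_all add: finite_closed_cantor)
  show "\<not> cyl x l \<subseteq> A" if A: "A \<in> sigma_closed_null_sets" for A x l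
  proof
    assume sub: "cyl x l \<subseteq> A"
    obtain C where C: "\<And>n. C n \<in> null_sets cantor_measure" "A \<subseteq> (\<Union>n :: nat. C n)"
      using sigma_closed_null_cover[OF A] by blast
    have "(\<Union>n. C n) \<in> null_sets cantor_measure" using C(1) by (rule null_sets_UN)
    moreover have "cyl x l \<subseteq> (\<Union>n. C n)" using sub C(2) by (rule subset_trans)
    ultimately have "cyl x l \<in> null_sets cantor_measure"
      by (rule null_sets_subset[OF _ open_cantor_measurable[OF open_cyl]])
    then have "measure cantor_measure (cyl x l) = 0" by (simp add: measure_def null_setsD1)
    then show False by (simp add: measure_cyl)
  qed
  show "{y. \<exists>z\<in>A. finite {i. y i \<noteq> z i}} \<in> sigma_closed_null_sets"
    if A: "A \<in> sigma_closed_null_sets" for A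
  proof -
    obtain C where C: "\<And>n. closed (C n)" "\<And>n. C n \<in> null_sets cantor_measure" "A \<subseteq> (\<Union>n :: nat. C n)"
      using sigma_closed_null_cover[OF A] by blast
    define flip where "flip S = (\<lambda>y i. y i \<noteq> (i \<in> S))" for S :: "nat set"
    have cl: "closed (flip S -` C n)" for S n
      unfolding closed_cyl_iff
    proof (intro allI impI)
      fix y assume "y \<notin> flip S -` C n"
      then obtain l where l: "cyl (flip S y) l \<inter> C n = {}"
        using C(1)[of n] unfolding closed_cyl_iff by auto
      have "flip S z \<in> cyl (flip S y) l" if "z \<in> cyl y l" for z
        using that by (auto simp: cyl_def flip_def)
      then have "cyl y l \<inter> flip S -` C n = {}" using l by auto
      then show "\<exists>l. cyl y l \<inter> flip S -` C n = {}" ..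
    qed
    have nl: "flip S -` C n \<in> null_sets cantor_measure" for S n
    proof -
      have "emeasure cantor_measure (flip S -` C n) =
          emeasure (distr cantor_measure cantor_measure (flip S)) (C n)"
        unfolding flip_def using closed_cantor_measurable[OF C(1)]
        by (subst emeasure_distr[OF measurable_flip]) simp_all
      also have "\<dots> = 0" unfolding flip_def distr_flip using C(2) by (rule null_setsD1)
      finally show ?thesis using closed_cantor_measurable[OF cl] by (intro null_setsI) auto
    qed
    have "countable {S :: nat set. finite S}" by (rule countable_Collect_finite)
    then have r: "range (from_nat_into {S :: nat set. finite S}) = {S. finite S}"
      by (intro range_from_nat_into) auto
    define e where "e = from_nat_into {S :: nat set. finite S}"
    have "(\<Union>m. \<Union>n. flip (e m) -` C n) \<in> sigma_closed_null_sets"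
    proof -
      have "flip (e m) -` C n \<in> sigma_closed_null_sets" for m n
        using cl nl by (rule sigma_closed_nullI)
      then have "(\<Union>n. flip (e m) -` C n) \<in> sigma_closed_null_sets" for m by (rule null_UN)
      then show ?thesis by (rule null_UN)
    qed
    moreover have "{y. \<exists>z\<in>A. finite {i. y i \<noteq> z i}} \<subseteq> (\<Union>m. \<Union>n. flip (e m) -` C n)"
    proof
      fix y assume "y \<in> {y. \<exists>z\<in>A. finite {i. y i \<noteq> z i}}"
      then obtain z where z: "z \<in> A" "finite {i. y i \<noteq> z i}" by blast
      have "{i. y i \<noteq> z i} \<in> range e" using z(2) r by (simp add: e_def)
      then obtain m where m: "{i. y i \<noteq> z i} = e m" by blast
      have "flip (e m) y = z" unfolding flip_def m[symmetric] by auto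
      moreover obtain n where "z \<in> C n" using z(1) C(3) by blast
      ultimately have "y \<in> flip (e m) -` C n" by simp
      then show "y \<in> (\<Union>m. \<Union>n. flip (e m) -` C n)" by blast
    qed
    ultimately show ?thesis by (rule null_subset)
  qed
qed

definition zeros :: "nat set \<Rightarrow> cantor set" where
  "zeros H = {y. \<forall>i\<in>H. \<not> y i}"

definition almost_zeros :: "nat set \<Rightarrow> cantor set" where
  "almost_zeros H = {y. finite {i \<in> H. y i}}"

lemma closed_zeros: "closed (zeros H)"
  unfolding closed_cyl_iff
proof (intro allI impI)
  fix y assume "y \<notin> zeros H"
  then obtain i where "i \<in> H" "y i" by (auto simp: zeros_def)
  then have "cyl y (Suc i) \<inter> zeros H = {}" by (auto simp: cyl_def zeros_def)
  then show "\<exists>l. cyl y l \<inter> zeros H = {}" ..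
qed

lemma measure_zeros: "finite S \<Longrightarrow> measure cantor_measure (zeros S) = (1 / 2) ^ card S"
  using measure_agree[of S "\<lambda>_. False"] by (simp add: zeros_def)

lemma zeros_null:
  assumes "infinite H"
  shows "zeros H \<in> null_sets cantor_measure"
proof (rule closed_nullI[OF closed_zeros])
  fix n
  obtain S where S: "finite S" "card S = n" "S \<subseteq> H"
    using infinite_arbitrarily_large[OF assms] by blast
  have "zeros H \<subseteq> zeros S" using S(3) by (auto simp: zeros_def)
  then have "measure cantor_measure (zeros H) \<le> measure cantor_measure (zeros S)"
    using closed_cantor_measurable[OF closed_zeros] by (intro cantor.finite_measure_mono)
  then show "measure cantor_measure (zeros H) \<le> (1 / 2) ^ n" using S by (simp add: measure_zeros)
qed

lemma almost_zeros_UN: "almost_zeros H \<subseteq> (\<Union>n. zeros (H \<inter> {n..}))"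
proof
  fix y assume "y \<in> almost_zeros H"
  then obtain n where "\<forall>i\<in>{i \<in> H. y i}. i < n"
    unfolding almost_zeros_def finite_nat_set_iff_bounded by blast
  then have "y \<in> zeros (H \<inter> {n..})" by (auto simp: zeros_def)
  then show "y \<in> (\<Union>n. zeros (H \<inter> {n..}))" by blast
qed

lemma almost_zeros_tail:
  assumes "y \<in> almost_zeros H" "finite {i. z i \<noteq> y i}"
  shows "z \<in> almost_zeros H"
proof -
  have "finite ({i \<in> H. y i} \<union> {i. z i \<noteq> y i})" using assms by (simp add: almost_zeros_def)
  then have "finite {i \<in> H. z i}" by (rule finite_subset[rotated]) auto
  then show ?thesis by (simp add: almost_zeros_def)
qed

lemma almost_zeros_UN_sigma_closed_null:
  assumes D: "countable D" "closure D = UNIV"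
    and small: "\<not> b_ideal D (NULL D) \<le>o |\<A>|"
    and inf: "\<And>A. A \<in> \<A> \<Longrightarrow> infinite (H A)"
  shows "(\<Union>A\<in>\<A>. almost_zeros (H A)) \<in> sigma_closed_null_sets"
proof (rule ccontr)
  assume large: "(\<Union>A\<in>\<A>. almost_zeros (H A)) \<notin> sigma_closed_null_sets"
  have "\<exists>F. unbounded_below D (closure_ideal D sigma_closed_null_sets) F \<and>
      |F| \<le>o |(\<lambda>A. almost_zeros (H A)) ` \<A>|"
  proof (rule null.ex_unbounded_below[OF D])
    fix B assume "B \<in> (\<lambda>A. almost_zeros (H A)) ` \<A>"
    then obtain A where A: "A \<in> \<A>" "B = almost_zeros (H A)" by blast
    have "zeros (H A \<inter> {n..}) \<in> sigma_closed_null_sets" for n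
    proof (intro sigma_closed_nullI closed_zeros zeros_null)
      have "H A \<subseteq> (H A \<inter> {n..}) \<union> {..<n}" by auto
      then show "infinite (H A \<inter> {n..})"
        using inf[OF A(1)] finite_subset[of "H A"] by (metis finite_Un finite_lessThan)
    qed
    then show "\<exists>N. (\<forall>n. closed (N n) \<and> N n \<in> sigma_closed_null_sets) \<and> B \<subseteq> (\<Union>n :: nat. N n)"
      unfolding A(2) using almost_zeros_UN closed_zeros
      by (intro exI[of _ "\<lambda>n. zeros (H A \<inter> {n..})"]) simp
    show "y \<in> B \<Longrightarrow> finite {i. z i \<noteq> y i} \<Longrightarrow> z \<in> B" for y z
      unfolding A(2) by (rule almost_zeros_tail)
  qed (use large in simp)
  then obtain F where F: "unbounded_below D (NULL D) F" "|F| \<le>o |(\<lambda>A. almost_zeros (H A)) ` \<A>|"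
    unfolding NULL_def by blast
  have "b_ideal D (NULL D) \<le>o |\<A>|"
    using ordLeq_transitive[OF ordLeq_transitive[OF b_ideal_le[OF F(1)] F(2)] card_of_image] .
  then show False using small by blast
qed

subsection \<open>The lower bound for NULL\<close>

definition finitely_determined :: "cantor set \<Rightarrow> bool" where
  "finitely_determined V \<longleftrightarrow> (\<exists>l. \<forall>y z. z \<in> cyl y l \<longrightarrow> y \<in> V \<longrightarrow> z \<in> V)"

lemma countable_finitely_determined: "countable {V. finitely_determined V}"
proof -
  define \<V> where "\<V> l = {V. \<forall>y z. z \<in> cyl y l \<longrightarrow> y \<in> V \<longrightarrow> z \<in> V}" for l
  define R where "R l = range (\<lambda>y. splice l y (\<lambda>_. False))" for l
  have "inj_on (\<lambda>V. V \<inter> R l) (\<V> l)" for l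
  proof (rule inj_onI)
    have "V \<subseteq> W" if V: "V \<in> \<V> l" and W: "W \<in> \<V> l" and eq: "V \<inter> R l = W \<inter> R l" for V W
    proof
      fix y assume y: "y \<in> V"
      let ?t = "splice l y (\<lambda>_. False)"
      have "?t \<in> V" using V y splice_in_cyl unfolding \<V>_def by blast
      then have "?t \<in> W" using eq by (auto simp: R_def)
      moreover have "y \<in> cyl ?t l" by (simp add: cyl_def splice_def)
      ultimately show "y \<in> W" using W unfolding \<V>_def by blast
    qed
    then show "V \<in> \<V> l \<Longrightarrow> W \<in> \<V> l \<Longrightarrow> V \<inter> R l = W \<inter> R l \<Longrightarrow> V = W" for V W
      by (metis subset_antisym)
  qed
  moreover have "finite ((\<lambda>V. V \<inter> R l) ` \<V> l)" for l
    by (rule finite_subset[of _ "Pow (R l)"]) (auto simp: R_def finite_range_trunc)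
  ultimately have "finite (\<V> l)" for l using finite_imageD by blast
  then have "countable (\<Union>l. \<V> l)" by (simp add: countable_finite)
  moreover have "{V. finitely_determined V} = (\<Union>l. \<V> l)"
    unfolding finitely_determined_def \<V>_def by blast
  ultimately show ?thesis by simp
qed

lemma finitely_determined_complement_nbhd: "finitely_determined (- nbhd C l)"
proof -
  have "z \<in> cyl y l \<Longrightarrow> z \<in> nbhd C l \<Longrightarrow> y \<in> nbhd C l" for y z
    by (rule nbhd_cyl[of z]) (auto simp: cyl_def)
  then show ?thesis unfolding finitely_determined_def by blast
qed

lemma open_finitely_determined: "finitely_determined V \<Longrightarrow> open V"
  unfolding finitely_determined_def open_cyl_iff by blast

lemma p_le:
  fixes \<A> :: "nat set set"
  assumes "\<And>A. A \<in> \<A> \<Longrightarrow> infinite A"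
    and "\<And>\<B>. \<B> \<subseteq> \<A> \<Longrightarrow> finite \<B> \<Longrightarrow> infinite (\<Inter>\<B>)"
    and "\<And>S. infinite S \<Longrightarrow> \<exists>A\<in>\<A>. infinite (S - A)"
  shows "pseudointersection_number \<le>o |\<A>|"
  unfolding pseudointersection_number_def
  by (rule least_card_le_member) (use assms in blast)

text \<open>A pseudointersection of the sets of pairs \<open>(j, V)\<close> with \<open>V\<close> clopen, of measure at least
  \<open>1 - 2\<^sup>-\<^sup>j\<close> and disjoint from \<open>{f \<le> j}\<close> selects clopen sets whose limit superior has full
  measure and which, for each \<open>f\<close>, eventually avoid \<open>{f \<le> j}\<close>.\<close>

lemma p_le_unbounded_below_NULL:
  assumes D: "countable D" and F: "unbounded_below D (NULL D) F"
  shows "pseudointersection_number \<le>o |F|"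
proof -
  interpret J: countable_ideal D "NULL D"
    unfolding NULL_def by (rule null.countable_ideal_closure_ideal[OF D])
  have F1: "F \<subseteq> ideal_to_one D (NULL D)" using F by (simp add: unbounded_below_def)
  define W where "W = {(j :: nat, V). finitely_determined V \<and> measure cantor_measure V \<ge> 1 - (1 / 2) ^ j}"
  have "W \<subseteq> UNIV \<times> {V. finitely_determined V}" by (auto simp: W_def)
  moreover have "countable (UNIV \<times> {V. finitely_determined V} :: (nat \<times> cantor set) set)"
    using countable_finitely_determined by (intro countable_SIGMA) auto
  ultimately have cW: "countable W" by (rule countable_subset)
  define c where "c = to_nat_on W"
  have c: "inj_on c W" unfolding c_def using cW by (rule inj_on_to_nat_on)
  define P where "P f = {(j, V) \<in> W. V \<inter> {x \<in> D. f x \<le> j} = {}}" for f :: "cantor \<Rightarrow> nat"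
  define Q where "Q m = {(j, V) \<in> W. j \<ge> m}" for m
  have PW: "P f \<subseteq> W" and QW: "Q m \<subseteq> W" for f m by (auto simp: P_def Q_def)
  define \<P> where "\<P> = (\<lambda>f. c ` P f) ` F"
  define \<Q> where "\<Q> = range (\<lambda>m. c ` Q m)"
  define \<A> where "\<A> = \<P> \<union> \<Q>"
  have fip: "infinite (\<Inter>\<B>)" if B: "\<B> \<subseteq> \<A>" "finite \<B>" for \<B>
  proof -
    obtain F0 where F0: "finite F0" "F0 \<subseteq> F" "\<B> \<inter> \<P> = (\<lambda>f. c ` P f) ` F0"
      using finite_subset_image[of "\<B> \<inter> \<P>" "\<lambda>f. c ` P f" F] B(2) by (auto simp: \<P>_def)
    obtain M0 where M0: "finite M0" "\<B> \<inter> \<Q> = (\<lambda>m. c ` Q m) ` M0"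
      using finite_subset_image[of "\<B> \<inter> \<Q>" "\<lambda>m. c ` Q m" UNIV] B(2) by (auto simp: \<Q>_def)
    obtain m where m: "\<forall>i\<in>M0. i \<le> m" using M0(1) finite_nat_set_iff_bounded_le by blast
    have "\<exists>V. (j, V) \<in> W \<and> (\<forall>f\<in>F0. (j, V) \<in> P f)" for j
    proof -
      have "(\<Union>f\<in>F0. {x \<in> D. f x \<le> j}) \<in> NULL D"
        using F0(1,2)
      proof (induction F0 rule: finite_induct)
        case (insert f F0)
        have "{x \<in> D. f x \<le> j} \<in> NULL D" using insert.prems F1 by (intro J.ideal_to_one_le) auto
        then have "{x \<in> D. f x \<le> j} \<union> (\<Union>f\<in>F0. {x \<in> D. f x \<le> j}) \<in> NULL D"
          using insert by (intro J.Un) auto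
        then show ?case by simp
      qed (simp add: J.empty)
      then have cl: "closure (\<Union>f\<in>F0. {x \<in> D. f x \<le> j}) \<in> sigma_closed_null_sets"
        by (simp add: NULL_def closure_ideal_def)
      define N where "N = closure (\<Union>f\<in>F0. {x \<in> D. f x \<le> j})"
      have "closed N" by (simp add: N_def)
      obtain C where C: "\<And>n. C n \<in> null_sets cantor_measure" "N \<subseteq> (\<Union>n :: nat. C n)"
        using sigma_closed_null_cover[OF cl] unfolding N_def by blast
      have "(\<Union>n. C n) \<in> null_sets cantor_measure" using C(1) by (rule null_sets_UN)
      then have "N \<in> null_sets cantor_measure"
        by (rule null_sets_subset[OF _ closed_cantor_measurable[OF \<open>closed N\<close>] C(2)])
      then obtain l where l: "measure cantor_measure (nbhd N l) < (1 / 2) ^ j"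
        using null_nbhd[OF \<open>closed N\<close>, of "(1 / 2) ^ j"] by auto
      have "measure cantor_measure (- nbhd N l) = 1 - measure cantor_measure (nbhd N l)"
        using cantor.prob_compl[OF open_cantor_measurable[OF open_nbhd]] by (simp add: Compl_eq_Diff_UNIV)
      then have "(j, - nbhd N l) \<in> W"
        using l finitely_determined_complement_nbhd by (simp add: W_def)
      moreover have "- nbhd N l \<inter> {x \<in> D. f x \<le> j} = {}" if "f \<in> F0" for f
      proof -
        have "{x \<in> D. f x \<le> j} \<subseteq> (\<Union>f\<in>F0. {x \<in> D. f x \<le> j})" using that by blast
        also have "\<dots> \<subseteq> N" unfolding N_def by (rule closure_subset)
        also have "N \<subseteq> nbhd N l" by (rule subset_nbhd)
        finally show ?thesis by blast
      qed
      ultimately show ?thesis by (intro exI[of _ "- nbhd N l"]) (auto simp: P_def)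
    qed
    then have "\<forall>j. \<exists>V. (j, V) \<in> W \<and> (\<forall>f\<in>F0. (j, V) \<in> P f)" by (rule allI)
    then obtain V where V: "\<forall>j. (j, V j) \<in> W \<and> (\<forall>f\<in>F0. (j, V j) \<in> P f)"
      by (auto simp only: choice_iff)
    have "inj_on (\<lambda>j. c (j, V j)) {m..}"
      using c V by (auto simp: inj_on_def)
    then have "infinite ((\<lambda>j. c (j, V j)) ` {m..})"
      using finite_imageD infinite_Ici by blast
    moreover have "(\<lambda>j. c (j, V j)) ` {m..} \<subseteq> \<Inter>\<B>"
    proof (intro image_subsetI InterI)
      fix j B assume "j \<in> {m..}" and "B \<in> \<B>"
      then have j: "m \<le> j" by simp
      have "B \<in> \<B> \<inter> \<P> \<or> B \<in> \<B> \<inter> \<Q>" using B(1) \<open>B \<in> \<B>\<close> unfolding \<A>_def by blast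
      then consider "B \<in> (\<lambda>f. c ` P f) ` F0" | "B \<in> (\<lambda>m. c ` Q m) ` M0"
        unfolding F0(3) M0(2) by (elim disjE)
      then show "c (j, V j) \<in> B"
      proof cases
        case 1
        then show ?thesis using V by auto
      next
        case 2
        then obtain i where i: "i \<in> M0" "B = c ` Q i" by blast
        have "(j, V j) \<in> Q i" using V m i(1) j unfolding Q_def by auto
        then show ?thesis using i(2) by blast
      qed
    qed
    ultimately show ?thesis using finite_subset by blast
  qed
  have "pseudointersection_number \<le>o |\<A>|"
  proof (rule p_le)
    show "infinite A" if "A \<in> \<A>" for A using fip[of "{A}"] that by simp
    show "\<B> \<subseteq> \<A> \<Longrightarrow> finite \<B> \<Longrightarrow> infinite (\<Inter>\<B>)" for \<B> by (rule fip)
    fix S :: "nat set" assume S: "infinite S"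
    show "\<exists>A\<in>\<A>. infinite (S - A)"
    proof (rule ccontr)
      assume "\<not> ?thesis"
      then have fin: "finite (S - A)" if "A \<in> \<A>" for A using that by blast
      have "\<exists>p. p \<in> W \<and> c p \<in> S \<and> i \<le> fst p" for i
      proof -
        have "finite (S - c ` Q i)" by (rule fin) (simp add: \<A>_def \<Q>_def)
        then have "infinite (S \<inter> c ` Q i)"
          using S by (metis Int_Diff_Un finite_Un)
        then obtain s where "s \<in> S" "s \<in> c ` Q i" using infinite_imp_nonempty by blast
        then show ?thesis unfolding Q_def by auto
      qed
      then have "\<forall>i. \<exists>p. p \<in> W \<and> c p \<in> S \<and> i \<le> fst p" by (rule allI)
      then obtain p0 where p0: "\<forall>i. p0 i \<in> W \<and> c (p0 i) \<in> S \<and> i \<le> fst (p0 i)"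
        by (auto simp only: choice_iff)
      define V where "V i = snd (p0 i)" for i
      define j where "j i = fst (p0 i)" for i
      have j: "i \<le> j i" for i using p0 by (simp add: j_def)
      have VW: "finitely_determined (V i)" "measure cantor_measure (V i) \<ge> 1 - (1 / 2) ^ j i" for i
        using p0[rule_format, of i] by (auto simp: V_def j_def W_def case_prod_beta)
      define U where "U n = (\<Union>i\<in>{n..}. V i)" for n
      have openO: "open (U n)" for n
        unfolding U_def using VW(1) open_finitely_determined by (intro open_UN) auto
      have Om: "measure cantor_measure (- U n) \<le> (1 / 2) ^ k" for n k
      proof -
        have "V (max n k) \<subseteq> U n" unfolding U_def by (rule UN_upper) simp
        then have "measure cantor_measure (V (max n k)) \<le> measure cantor_measure (U n)"
          using openO open_cantor_measurable by (intro cantor.finite_measure_mono) auto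
        moreover have "measure cantor_measure (- U n) = 1 - measure cantor_measure (U n)"
          using cantor.prob_compl[OF open_cantor_measurable[OF openO]] by (simp add: Compl_eq_Diff_UNIV)
        moreover have "(1 / 2 :: real) ^ j (max n k) \<le> (1 / 2) ^ k"
          using j[of "max n k"] by (intro power_decreasing) auto
        ultimately show ?thesis using VW(2)[of "max n k"] by linarith
      qed
      define C where "C n = D - U n" for n
      have "C n \<in> NULL D" for n
      proof -
        have cl: "closed (- U n)" using openO by (simp add: closed_Compl)
        then have "- U n \<in> sigma_closed_null_sets"
          using closed_nullI[OF cl Om] by (rule sigma_closed_nullI)
        moreover have "closure (C n) \<subseteq> - U n"
          using cl by (intro closure_minimal) (auto simp: C_def)
        ultimately have "closure (C n) \<in> sigma_closed_null_sets" by (rule null.subset)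
        then show ?thesis by (simp add: NULL_def closure_ideal_def C_def)
      qed
      then have "\<not> unbounded_below D (NULL D) F"
      proof (rule J.lower_bound[OF _ F1])
        fix f assume f: "f \<in> F"
        have "finite (S - c ` P f)" by (rule fin) (use f in \<open>simp add: \<A>_def \<P>_def\<close>)
        then have "finite (c -` (S - c ` P f) \<inter> W)" using c by (rule finite_vimage_IntI)
        then have "finite (fst ` (c -` (S - c ` P f) \<inter> W))" by (rule finite_imageI)
        then obtain N where N: "\<forall>n\<in>fst ` (c -` (S - c ` P f) \<inter> W). n < N"
          using finite_nat_set_iff_bounded by blast
        have "{x \<in> D. f x \<le> n} \<subseteq> C n" if n: "n \<ge> N" for n
        proof
          fix x assume x: "x \<in> {x \<in> D. f x \<le> n}"
          have "x \<notin> V i" if i: "n \<le> i" for i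
          proof -
            have "\<not> fst (p0 i) < N" using j[of i] i n unfolding j_def by linarith
            then have "p0 i \<notin> c -` (S - c ` P f) \<inter> W" using N by blast
            then have "c (p0 i) \<in> c ` P f" using p0 by blast
            then have "p0 i \<in> P f" using c p0 PW[of f] by (meson inj_on_image_mem_iff)
            then have "V i \<inter> {x \<in> D. f x \<le> j i} = {}"
              by (auto simp: P_def V_def j_def case_prod_beta)
            then show ?thesis using x i j[of i] by auto
          qed
          then show "x \<in> C n" using x by (auto simp: C_def U_def)
        qed
        then show "\<exists>N. \<forall>n\<ge>N. {x \<in> D. f x \<le> n} \<subseteq> C n" by blast
      qed
      then show False using F by blast
    qed
  qed
  moreover have "|\<A>| \<le>o |F|"
  proof -
    have inf: "natLeq <o |F|"
      by (intro natLeq_less_uncountable J.unbounded_below_uncountable[OF F])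
    then have "infinite F"
      using J.unbounded_below_uncountable[OF F] countable_finite by blast
    moreover have "|\<Q>| \<le>o |UNIV :: nat set|" unfolding \<Q>_def by (rule card_of_image)
    then have "|\<Q>| \<le>o |F|"
      using inf card_of_nat by (meson ordIso_ordLeq_trans ordLess_imp_ordLeq ordLeq_ordIso_trans ordLeq_transitive)
    moreover have "|\<P>| \<le>o |F|" unfolding \<P>_def by (rule card_of_image)
    ultimately show ?thesis
      unfolding \<A>_def by (intro card_of_Un_ordLeq_infinite_Field) (simp_all add: Field_card_of card_of_card_order_on)
  qed
  ultimately show ?thesis by (rule ordLeq_transitive)
qed

subsection \<open>Covering by closed null sets\<close>

lemma Baire_closed:
  fixes Z :: "cantor set"
  assumes Z: "closed Z" "Z \<noteq> {}" and C: "\<And>n :: nat. closed (C n)" "Z \<subseteq> (\<Union>n. C n)"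
  shows "\<exists>n. \<exists>y\<in>Z. \<exists>l. Z \<inter> cyl y l \<subseteq> C n"
proof (rule ccontr)
  assume neg: "\<not> ?thesis"
  have step: "\<exists>z k. z \<in> Z \<and> l < k \<and> z \<in> cyl y l \<and> cyl z k \<inter> C n = {}" if "y \<in> Z" for y l n
  proof -
    have "\<not> Z \<inter> cyl y l \<subseteq> C n" using neg that by blast
    then obtain z where z: "z \<in> Z" "z \<in> cyl y l" "z \<notin> C n" by blast
    then obtain k where k: "cyl z k \<inter> C n = {}" using C(1)[of n] unfolding closed_cyl_iff by blast
    have "cyl z (max k (Suc l)) \<inter> C n = {}" using k cyl_antimono[of k "max k (Suc l)" z] by auto
    then show ?thesis using z by (intro exI[of _ z] exI[of _ "max k (Suc l)"]) simp
  qed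
  have "\<exists>p. \<forall>n. fst (p n) \<in> Z \<and>
      (snd (p n) < snd (p (Suc n)) \<and> fst (p (Suc n)) \<in> cyl (fst (p n)) (snd (p n)) \<and>
       cyl (fst (p (Suc n))) (snd (p (Suc n))) \<inter> C n = {})"
  proof (rule dependent_nat_choice)
    obtain y where "y \<in> Z" using Z(2) by blast
    then show "\<exists>q :: cantor \<times> nat. fst q \<in> Z" by (intro exI[of _ "(y, 0)"]) simp
    fix q :: "cantor \<times> nat" and n
    assume "fst q \<in> Z"
    from step[OF this, of "snd q" n] obtain z k where
      "z \<in> Z" "snd q < k" "z \<in> cyl (fst q) (snd q)" "cyl z k \<inter> C n = {}" by blast
    then show "\<exists>r :: cantor \<times> nat. fst r \<in> Z \<and> (snd q < snd r \<and> fst r \<in> cyl (fst q) (snd q) \<and> cyl (fst r) (snd r) \<inter> C n = {})"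
      by (intro exI[of _ "(z, k)"]) simp
  qed
  then obtain p where p: "\<forall>n. fst (p n) \<in> Z \<and>
      (snd (p n) < snd (p (Suc n)) \<and> fst (p (Suc n)) \<in> cyl (fst (p n)) (snd (p n)) \<and>
       cyl (fst (p (Suc n))) (snd (p (Suc n))) \<inter> C n = {})" by (rule exE)
  define x where "x n = fst (p n)" for n
  define l where "l n = snd (p n)" for n
  have xZ: "x n \<in> Z" and lS: "l n < l (Suc n)" and xS: "x (Suc n) \<in> cyl (x n) (l n)"
    and xC: "cyl (x (Suc n)) (l (Suc n)) \<inter> C n = {}" for n
    using p unfolding x_def l_def by auto
  have l: "strict_mono l" using lS by (simp add: strict_mono_Suc_iff)
  have agree: "x m \<in> cyl (x n) (l n)" if "n \<le> m" for m n
    using that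
  proof (induction m rule: dec_induct)
    case (step m)
    have "l n \<le> l m" using l step(1) by (simp add: strict_mono_less_eq)
    then show ?case using step(3) xS[of m] by (auto simp: cyl_def)
  qed simp
  define y where "y i = x (Suc i) i" for i
  have yc: "y \<in> cyl (x n) (l n)" for n
    unfolding cyl_def
  proof (intro CollectI allI impI)
    fix i assume i: "i < l n"
    show "y i = x n i"
    proof (cases "n \<le> Suc i")
      case True
      then show ?thesis using agree[OF True] i by (auto simp: cyl_def y_def)
    next
      case False
      have "i < l (Suc i)" using strict_mono_imp_increasing[OF l, of "Suc i"] by simp
      then show ?thesis using agree[of "Suc i" n] False by (auto simp: cyl_def y_def)
    qed
  qed
  have "y \<in> closure Z"
    unfolding closure_cyl_iff
  proof
    fix k
    have "x k \<in> cyl y k"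
      using yc[of k] strict_mono_imp_increasing[OF l, of k] by (auto simp: cyl_def)
    then show "cyl y k \<inter> Z \<noteq> {}" using xZ by blast
  qed
  then have "y \<in> Z" using Z(1) by simp
  then obtain n where "y \<in> C n" using C(2) by blast
  then show False using yc[of "Suc n"] xC[of n] by blast
qed

text \<open>The sets \<open>H\<close> with \<open>zeros H\<close> included (above a given string) in a fixed closed set without
  interior form a compact family of infinite sets, so the gaps of its members are uniformly bounded.\<close>

lemma uniform_gap:
  assumes C: "closed C" "\<And>x l. \<not> cyl x l \<subseteq> C"
  shows "\<exists>k. \<forall>H. {z \<in> cyl y l. \<forall>i\<in>H. l \<le> i \<longrightarrow> \<not> z i} \<subseteq> C \<longrightarrow> (\<exists>i\<in>H. j \<le> i \<and> i < k)"
proof (rule ccontr)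
  assume "\<not> ?thesis"
  then have "\<forall>k. \<exists>H. {z \<in> cyl y l. \<forall>i\<in>H. l \<le> i \<longrightarrow> \<not> z i} \<subseteq> C \<and> \<not> (\<exists>i\<in>H. j \<le> i \<and> i < k)"
    unfolding not_ex not_all not_imp .
  then obtain H where H: "\<forall>k. {z \<in> cyl y l. \<forall>i\<in>H k. l \<le> i \<longrightarrow> \<not> z i} \<subseteq> C \<and> \<not> (\<exists>i\<in>H k. j \<le> i \<and> i < k)"
    by (auto simp only: choice_iff)
  define w where "w = splice l y (\<lambda>_. False)"
  have "cyl w (max l j) \<subseteq> closure C"
  proof
    fix z assume z: "z \<in> cyl w (max l j)"
    show "z \<in> closure C"
      unfolding closure_cyl_iff
    proof
      fix k
      define z' where "z' = splice (max k (max l j)) z (\<lambda>_. False)"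
      have "z' \<in> cyl y l" using z by (auto simp: z'_def w_def cyl_def splice_def)
      moreover have "\<not> z' i" if "i \<in> H (max k (max l j))" "l \<le> i" for i
      proof (cases "i < j")
        case True
        then have "z i = w i" using z by (auto simp: cyl_def)
        then show ?thesis using True that(2) by (auto simp: z'_def w_def splice_def)
      next
        case False
        then have "\<not> i < max k (max l j)" using H that(1) by auto
        then show ?thesis by (auto simp: z'_def splice_def)
      qed
      ultimately have "z' \<in> C" using H by blast
      moreover have "z' \<in> cyl z k" by (auto simp: z'_def cyl_def splice_def)
      ultimately show "cyl z k \<inter> C \<noteq> {}" by blast
    qed
  qed
  then show False using C by simp
qed

lemma gap_bound:
  assumes cover: "(\<Union>A\<in>\<A>. almost_zeros (H A)) \<in> sigma_closed_null_sets"
  shows "\<exists>B. \<forall>A\<in>\<A>. \<exists>N. \<forall>l\<ge>N. \<exists>i\<in>H A. l \<le> i \<and> i < B l"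
proof -
  obtain C where C: "\<And>n. closed (C n)" "\<And>n. C n \<in> null_sets cantor_measure"
    "(\<Union>A\<in>\<A>. almost_zeros (H A)) \<subseteq> (\<Union>n :: nat. C n)"
    using sigma_closed_null_cover[OF cover] by blast
  have nocyl: "\<not> cyl x l \<subseteq> C n" for x l n
    using null.no_cyl[OF sigma_closed_nullI[OF C(1,2)]] .
  define str where "str s i \<longleftrightarrow> i < length s \<and> s ! i" for s :: "bool list" and i
  have "\<forall>p :: (nat \<times> bool list) \<times> nat. \<exists>k. \<forall>H. {z \<in> cyl (str (snd (fst p))) (length (snd (fst p))). \<forall>i\<in>H. length (snd (fst p)) \<le> i \<longrightarrow> \<not> z i}
      \<subseteq> C (fst (fst p)) \<longrightarrow> (\<exists>i\<in>H. snd p \<le> i \<and> i < k)"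
    using uniform_gap[OF C(1) nocyl] by (intro allI)
  then obtain K where K: "\<forall>p :: (nat \<times> bool list) \<times> nat. \<forall>H. {z \<in> cyl (str (snd (fst p))) (length (snd (fst p))). \<forall>i\<in>H. length (snd (fst p)) \<le> i \<longrightarrow> \<not> z i}
      \<subseteq> C (fst (fst p)) \<longrightarrow> (\<exists>i\<in>H. snd p \<le> i \<and> i < K p)"
    by (auto simp only: choice_iff)
  define B where "B l = Max ((\<lambda>j. K (from_nat j, l)) ` {..l})" for l
  have "\<exists>N. \<forall>l\<ge>N. \<exists>i\<in>H A. l \<le> i \<and> i < B l" if A: "A \<in> \<A>" for A
  proof -
    have "zeros (H A) \<subseteq> almost_zeros (H A)"
    proof
      fix y assume "y \<in> zeros (H A)"
      then have "{i \<in> H A. y i} = {}" by (auto simp: zeros_def)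
      then show "y \<in> almost_zeros (H A)" by (simp only: almost_zeros_def mem_Collect_eq finite.emptyI)
    qed
    then have "zeros (H A) \<subseteq> (\<Union>n. C n)" using C(3) A by blast
    moreover have "(\<lambda>_. False) \<in> zeros (H A)" by (simp add: zeros_def)
    then have "zeros (H A) \<noteq> {}" by blast
    ultimately have "\<exists>n. \<exists>y\<in>zeros (H A). \<exists>l. zeros (H A) \<inter> cyl y l \<subseteq> C n"
      using Baire_closed[OF closed_zeros _ C(1)] by simp
    then obtain n y l where y: "y \<in> zeros (H A)" "zeros (H A) \<inter> cyl y l \<subseteq> C n"
      by (elim exE bexE)
    define s where "s = map y [0..<l]"
    have s: "length s = l" "cyl (str s) l = cyl y l"
      by (auto simp: s_def str_def cyl_def)
    have sub: "{z \<in> cyl (str s) (length s). \<forall>i\<in>H A. length s \<le> i \<longrightarrow> \<not> z i} \<subseteq> C n"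
    proof
      fix z assume z: "z \<in> {z \<in> cyl (str s) (length s). \<forall>i\<in>H A. length s \<le> i \<longrightarrow> \<not> z i}"
      then have zc: "z \<in> cyl y l" using s by simp
      have "z \<in> zeros (H A)"
        unfolding zeros_def
      proof (intro CollectI ballI)
        fix i assume i: "i \<in> H A"
        show "\<not> z i"
        proof (cases "l \<le> i")
          case True
          then show ?thesis using z s(1) i by simp
        next
          case False
          then have "z i = y i" using zc by (simp add: cyl_def)
          then show ?thesis using y(1) i by (simp add: zeros_def)
        qed
      qed
      then show "z \<in> C n" using y(2) zc by blast
    qed
    have "\<exists>i\<in>H A. m \<le> i \<and> i < B m" if m: "m \<ge> to_nat (n, s)" for m
    proof -
      obtain i where i: "i \<in> H A" "m \<le> i" "i < K ((n, s), m)"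
        using K[rule_format, of "((n, s), m)" "H A"] sub by auto
      have "K ((n, s), m) \<in> (\<lambda>j. K (from_nat j, m)) ` {..m}"
        using m by (intro image_eqI[where x = "to_nat (n, s)"]) auto
      then have "K ((n, s), m) \<le> B m" unfolding B_def by (intro Max_ge) auto
      then show ?thesis using i by (intro bexI[of _ i]) auto
    qed
    then show ?thesis by blast
  qed
  then show ?thesis by blast
qed

lemma positive_avoiding_set:
  assumes "A \<in> sigma_closed_null_sets"
  shows "\<exists>T. closed T \<and> T \<inter> A = {} \<and> measure cantor_measure T \<ge> 1 / 2"
proof -
  obtain C where C: "\<And>n. closed (C n)" "\<And>n. C n \<in> null_sets cantor_measure" "A \<subseteq> (\<Union>n :: nat. C n)"
    using sigma_closed_null_cover[OF assms] by blast
  have "\<forall>n. \<exists>l. measure cantor_measure (nbhd (C n) l) < (1 / 2) ^ (n + 2)"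
    by (intro allI null_nbhd[OF C(1,2)]) simp
  then obtain l where l: "\<forall>n. measure cantor_measure (nbhd (C n) (l n)) < (1 / 2) ^ (n + 2)"
    by (auto simp only: choice_iff)
  define U where "U = (\<Union>n. nbhd (C n) (l n))"
  have oU: "open U" unfolding U_def by (intro open_UN ballI open_nbhd)
  have sums: "(\<lambda>n. (1 / 2 :: real) ^ (n + 2)) sums (1 / 2)"
    using sums_mult[OF power_half_series, of "1 / 2"] by simp
  have sm: "summable (\<lambda>n. measure cantor_measure (nbhd (C n) (l n)))"
    by (rule summable_comparison_test'[OF sums_summable[OF sums], of 0]) (use l less_imp_le in auto)
  have "measure cantor_measure U \<le> (\<Sum>n. measure cantor_measure (nbhd (C n) (l n)))"
    unfolding U_def using sm open_cantor_measurable[OF open_nbhd]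
    by (intro cantor.finite_measure_subadditive_countably) auto
  also have "\<dots> \<le> (\<Sum>n. (1 / 2) ^ (n + 2))"
    using sm sums_summable[OF sums] l less_imp_le by (intro suminf_le) auto
  also have "\<dots> = 1 / 2" using sums by (simp only: sums_iff)
  finally have "measure cantor_measure U \<le> 1 / 2" .
  moreover have "measure cantor_measure (- U) = 1 - measure cantor_measure U"
    using cantor.prob_compl[OF open_cantor_measurable[OF oU]] by (simp add: Compl_eq_Diff_UNIV)
  moreover have "A \<subseteq> U" using C(3) subset_nbhd unfolding U_def by blast
  ultimately show ?thesis using oU by (intro exI[of _ "- U"]) (auto simp: closed_Compl)
qed

subsection \<open>Prediction by Bessel's inequality\<close>

definition cond_measure :: "cantor set \<Rightarrow> nat set \<Rightarrow> real" where
  "cond_measure T S = 2 ^ card S * measure cantor_measure (T \<inter> zeros S)"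

definition sgn_coord :: "nat \<Rightarrow> cantor \<Rightarrow> real" where
  "sgn_coord i y = (if y i then -1 else 1)"

lemma sgn_coord_measurable [measurable]: "sgn_coord i \<in> borel_measurable cantor_measure"
proof -
  have "{y :: cantor. y i} \<in> sets cantor_measure"
    using open_coord_set[of "\<lambda>b. b" i] by (rule open_cantor_measurable)
  moreover have "sgn_coord i = (\<lambda>y. 1 - 2 * indicator {y. y i} y)"
    by (auto simp: sgn_coord_def fun_eq_iff indicator_def)
  ultimately show ?thesis by simp
qed

lemma integrable_bounded_cantor:
  fixes f :: "cantor \<Rightarrow> real"
  assumes "f \<in> borel_measurable cantor_measure" "\<And>y. \<bar>f y\<bar> \<le> B"
  shows "integrable cantor_measure f"
  by (rule cantor.integrable_const_bound[of _ B]) (use assms in auto)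

text \<open>Flipping coordinate \<open>j\<close> preserves the measure and changes the sign of \<open>sgn_coord j\<close>.\<close>

lemma sgn_coord_orthogonal:
  assumes "j \<notin> S" "i \<noteq> j"
  shows "(\<integral>y. indicator (zeros S) y * (sgn_coord i y * sgn_coord j y) \<partial>cantor_measure) = 0"
proof -
  define f where "f y = indicator (zeros S) y * (sgn_coord i y * sgn_coord j y)" for y
  have zS [measurable]: "zeros S \<in> sets cantor_measure"
    by (rule closed_cantor_measurable[OF closed_zeros])
  have f [measurable]: "f \<in> borel_measurable cantor_measure" unfolding f_def by measurable
  have "integral\<^sup>L cantor_measure f =
      integral\<^sup>L (distr cantor_measure cantor_measure (\<lambda>y k. y k \<noteq> (k = j))) f"
    by (simp only: distr_flip)
  also have "\<dots> = (\<integral>y. f (\<lambda>k. y k \<noteq> (k = j)) \<partial>cantor_measure)"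
    by (rule integral_distr[OF measurable_flip f])
  also have "\<dots> = (\<integral>y. - f y \<partial>cantor_measure)"
  proof (rule Bochner_Integration.integral_cong)
    fix y
    have "(\<lambda>k. y k \<noteq> (k = j)) \<in> zeros S \<longleftrightarrow> y \<in> zeros S"
      using assms(1) by (auto simp: zeros_def)
    then show "f (\<lambda>k. y k \<noteq> (k = j)) = - f y"
      using assms(2) by (auto simp: f_def sgn_coord_def indicator_def)
  qed simp
  also have "\<dots> = - integral\<^sup>L cantor_measure f" by (rule integral_minus)
  finally have "integral\<^sup>L cantor_measure f = 0" by simp
  then show ?thesis unfolding f_def .
qed

text \<open>Bessel's inequality for the orthogonal functions \<open>sgn_coord i\<close> on \<open>zeros S\<close>.\<close>

lemma few_influential_coordinates:
  assumes T: "closed T" and S: "finite S" and M: "finite M" "M \<inter> S = {}" and "\<eta> > 0"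
    and drop: "\<And>i. i \<in> M \<Longrightarrow> cond_measure T (insert i S) \<le> cond_measure T S - \<eta>"
  shows "real (card M) \<le> 1 / \<eta>\<^sup>2"
proof -
  define z where "z = measure cantor_measure (zeros S)"
  define m where "m = real (card M)"
  have z: "z = (1 / 2) ^ card S" "z > 0" unfolding z_def measure_zeros[OF S] by simp_all
  have [measurable]: "zeros S' \<in> sets cantor_measure" for S'
    by (rule closed_cantor_measurable[OF closed_zeros])
  have [measurable]: "T \<in> sets cantor_measure" by (rule closed_cantor_measurable[OF T])
  define t where "t y = (indicator (T \<inter> zeros S) y :: real)" for y
  define R where "R y = (\<Sum>i\<in>M. sgn_coord i y)" for y
  have [measurable]: "t \<in> borel_measurable cantor_measure" "R \<in> borel_measurable cantor_measure"
    unfolding t_def R_def by measurable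
  have Rb: "\<bar>R y\<bar> \<le> m" for y
  proof -
    have "\<bar>R y\<bar> \<le> (\<Sum>i\<in>M. \<bar>sgn_coord i y\<bar>)" unfolding R_def by (rule sum_abs)
    also have "\<dots> = (\<Sum>i\<in>M. 1)" by (intro sum.cong) (auto simp: sgn_coord_def)
    also have "\<dots> = m" by (simp add: m_def)
    finally show ?thesis .
  qed
  have int_coord: "(\<integral>y. t y * sgn_coord i y \<partial>cantor_measure) \<le> - (\<eta> * z)" if i: "i \<in> M" for i
  proof -
    have "i \<notin> S" using i M(2) by blast
    have "t y * sgn_coord i y = 2 * indicator (T \<inter> zeros (insert i S)) y - indicator (T \<inter> zeros S) y" for y
      by (auto simp: t_def sgn_coord_def indicator_def zeros_def)
    then have "(\<integral>y. t y * sgn_coord i y \<partial>cantor_measure) =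
        (\<integral>y. 2 * indicator (T \<inter> zeros (insert i S)) y - indicator (T \<inter> zeros S) y \<partial>cantor_measure)"
      by simp
    also have "\<dots> = 2 * measure cantor_measure (T \<inter> zeros (insert i S)) - measure cantor_measure (T \<inter> zeros S)"
    proof -
      have "integrable cantor_measure (\<lambda>y. 2 * indicator (T \<inter> zeros (insert i S)) y :: real)"
        "integrable cantor_measure (\<lambda>y. indicator (T \<inter> zeros S) y :: real)"
        by (auto intro!: integrable_bounded_cantor[where B = 2] simp: indicator_def)
      then show ?thesis by (simp add: Bochner_Integration.integral_diff)
    qed
    also have "\<dots> = z * (cond_measure T (insert i S) - cond_measure T S)"
      using S \<open>i \<notin> S\<close> by (simp add: cond_measure_def z(1) power_one_over field_simps)
    also have "\<dots> \<le> z * (- \<eta>)"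
      using drop[OF i] z(2) by (intro mult_left_mono) auto
    finally show ?thesis by (simp add: mult.commute)
  qed
  have itR: "integrable cantor_measure (\<lambda>y. t y * sgn_coord i y)" for i
  proof (rule integrable_bounded_cantor)
    show "\<bar>t y * sgn_coord i y\<bar> \<le> 1" for y by (auto simp: t_def sgn_coord_def indicator_def)
  qed measurable
  have "(\<integral>y. t y * R y \<partial>cantor_measure) = (\<Sum>i\<in>M. \<integral>y. t y * sgn_coord i y \<partial>cantor_measure)"
    unfolding R_def sum_distrib_left using itR by (intro Bochner_Integration.integral_sum)
  also have "\<dots> \<le> (\<Sum>i\<in>M. - (\<eta> * z))" using int_coord by (rule sum_mono)
  finally have tR: "(\<integral>y. t y * R y \<partial>cantor_measure) \<le> - (m * \<eta> * z)" by (simp add: m_def)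
  have RR: "(\<integral>y. indicator (zeros S) y * (R y)\<^sup>2 \<partial>cantor_measure) = m * z"
  proof -
    have int: "integrable cantor_measure (\<lambda>y. indicator (zeros S) y * (sgn_coord i y * sgn_coord j y))" for i j
    proof (rule integrable_bounded_cantor)
      show "\<bar>indicator (zeros S) y * (sgn_coord i y * sgn_coord j y)\<bar> \<le> 1" for y
        by (auto simp: sgn_coord_def indicator_def)
    qed measurable
    have "(\<integral>y. indicator (zeros S) y * (R y)\<^sup>2 \<partial>cantor_measure) =
        (\<integral>y. (\<Sum>i\<in>M. \<Sum>j\<in>M. indicator (zeros S) y * (sgn_coord i y * sgn_coord j y)) \<partial>cantor_measure)"
      unfolding R_def power2_eq_square sum_product unfolding sum_distrib_left ..
    also have "\<dots> = (\<Sum>i\<in>M. \<Sum>j\<in>M. \<integral>y. indicator (zeros S) y * (sgn_coord i y * sgn_coord j y) \<partial>cantor_measure)"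
      using int by (simp add: Bochner_Integration.integral_sum)
    also have "\<dots> = (\<Sum>i\<in>M. \<Sum>j\<in>M. if i = j then z else 0)"
    proof (intro sum.cong refl)
      fix i j assume ij: "i \<in> M" "j \<in> M"
      show "(\<integral>y. indicator (zeros S) y * (sgn_coord i y * sgn_coord j y) \<partial>cantor_measure) = (if i = j then z else 0)"
      proof (cases "i = j")
        case True
        have "sgn_coord j y * sgn_coord j y = 1" for y
          by (simp add: sgn_coord_def)
        then show ?thesis using True by (simp add: z_def)
      next
        case False
        then show ?thesis using sgn_coord_orthogonal[of j S i] ij M(2) by auto
      qed
    qed
    also have "\<dots> = m * z" using M(1) by (simp add: m_def)
    finally show ?thesis .
  qed
  define a where "a = m * \<eta>"
  have i1: "integrable cantor_measure t"
  proof (rule integrable_bounded_cantor)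
    show "\<bar>t y\<bar> \<le> 1" for y by (auto simp: t_def indicator_def)
  qed measurable
  have i2: "integrable cantor_measure (\<lambda>y. t y * R y)"
  proof (rule integrable_bounded_cantor)
    show "\<bar>t y * R y\<bar> \<le> m" for y using Rb[of y] by (auto simp: t_def indicator_def abs_mult m_def)
  qed measurable
  have i3: "integrable cantor_measure (\<lambda>y. indicator (zeros S) y * (R y)\<^sup>2)"
  proof (rule integrable_bounded_cantor)
    show "\<bar>indicator (zeros S) y * (R y)\<^sup>2\<bar> \<le> m\<^sup>2" for y
      using power_mono[OF Rb[of y], of 2] by (auto simp: indicator_def)
  qed measurable
  have "0 \<le> (\<integral>y. indicator (zeros S) y * (a * t y + R y)\<^sup>2 \<partial>cantor_measure)"
    by (intro Bochner_Integration.integral_nonneg) simp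
  also have "\<dots> = (\<integral>y. a\<^sup>2 * t y + 2 * a * (t y * R y) + indicator (zeros S) y * (R y)\<^sup>2 \<partial>cantor_measure)"
    by (intro Bochner_Integration.integral_cong) (auto simp: t_def indicator_def power2_eq_square algebra_simps)
  also have "\<dots> = a\<^sup>2 * (\<integral>y. t y \<partial>cantor_measure) + 2 * a * (\<integral>y. t y * R y \<partial>cantor_measure) + m * z"
    using i1 i2 i3 RR by (simp add: Bochner_Integration.integral_add)
  also have "\<dots> \<le> a\<^sup>2 * z + 2 * a * (- (m * \<eta> * z)) + m * z"
  proof (intro add_mono mult_left_mono tR)
    have "(\<integral>y. t y \<partial>cantor_measure) = measure cantor_measure (T \<inter> zeros S)" unfolding t_def by simp
    also have "\<dots> \<le> z" unfolding z_def by (rule cantor.finite_measure_mono) auto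
    finally show "(\<integral>y. t y \<partial>cantor_measure) \<le> z" .
  qed (use \<open>\<eta> > 0\<close> in \<open>auto simp: a_def m_def\<close>)
  also have "\<dots> = z * (m * (1 - m * \<eta>\<^sup>2))"
    by (simp add: a_def power2_eq_square algebra_simps)
  finally have "0 \<le> m * (1 - m * \<eta>\<^sup>2)" using z(2) by (simp add: zero_le_mult_iff)
  then have "m * \<eta>\<^sup>2 \<le> 1" by (auto simp: zero_le_mult_iff m_def)
  then show ?thesis using \<open>\<eta> > 0\<close> by (simp add: m_def field_simps)
qed

definition threshold :: "nat \<Rightarrow> real" where
  "threshold n = 1 / 4 + 1 / (4 * (real n + 1))"

definition width :: "nat \<Rightarrow> nat" where
  "width n = (4 * (n + 1) * (n + 2))\<^sup>2"

lemma threshold_diff: "threshold n - threshold (Suc n) = 1 / (4 * (real n + 1) * (real n + 2))"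
proof -
  have "1 / (4 * a) - 1 / (4 * (a + 1)) = 1 / (4 * a * (a + 1))" if "a > 0" for a :: real
    using that by (simp add: divide_simps)
  from this[of "real n + 1"] show ?thesis by (simp add: threshold_def add.commute add.left_commute)
qed

lemma width_eq: "1 / (threshold n - threshold (Suc n))\<^sup>2 = real (width n)"
  unfolding threshold_diff by (simp add: width_def power_divide algebra_simps)

lemma threshold_pos: "threshold n > 0" "threshold n - threshold (Suc n) > 0"
  unfolding threshold_diff by (auto simp: threshold_def intro: add_pos_nonneg)

lemma threshold_le: "threshold n \<le> 1 / 2"
  by (simp add: threshold_def field_simps)

locale prefix_coding =
  fixes c :: "nat \<Rightarrow> nat"
  assumes c: "strict_mono c"
begin

definition prefix_code :: "cantor \<Rightarrow> nat \<Rightarrow> nat" where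
  "prefix_code x n = to_nat (map x [0..<c (Suc n)])"

lemma prefix_code_eqD: "prefix_code x n = prefix_code y m \<Longrightarrow> n = m"
proof -
  assume "prefix_code x n = prefix_code y m"
  then have "map x [0..<c (Suc n)] = map y [0..<c (Suc m)]" by (simp add: prefix_code_def)
  then have "c (Suc n) = c (Suc m)" by (metis length_map length_upt minus_nat.diff_0)
  then show "n = m" using c by (simp add: strict_mono_eq)
qed

lemma infinite_prefix_codes: "infinite (range (prefix_code x))"
  by (rule range_inj_infinite) (auto intro: injI dest: prefix_code_eqD)

end

locale prefix_slalom = prefix_coding +
  fixes T :: "cantor set"
  assumes closed: "closed T" and large: "measure cantor_measure T \<ge> 1 / 2"
begin

text \<open>The conditional measures start at \<open>1/2\<close> or more and have to reach \<open>0\<close>, while all thresholds exceed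
  \<open>1/4\<close>; so they fall below the threshold at some step, and the coordinate of that step is influential.\<close>

definition drops :: "cantor \<Rightarrow> nat \<Rightarrow> nat \<Rightarrow> bool" where
  "drops x l n \<longleftrightarrow> cond_measure T (prefix_code x ` {l..<n}) \<ge> threshold n \<and>
     cond_measure T (prefix_code x ` {l..<Suc n}) < threshold (Suc n)"

lemma ex_drops:
  assumes "T \<inter> almost_zeros (range (prefix_code x)) = {}"
  shows "\<exists>n\<ge>l. drops x l n"
proof (rule ccontr)
  assume nd: "\<not> ?thesis"
  have ge: "cond_measure T (prefix_code x ` {l..<n}) \<ge> threshold n" if "l \<le> n" for n
    using that
  proof (induction n rule: dec_induct)
    case base
    have "zeros {} = UNIV" by (simp add: zeros_def)
    then show ?case using large threshold_le[of l] by (simp add: cond_measure_def)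
  next
    case (step n)
    then show ?case using nd unfolding drops_def by force
  qed
  have "T \<inter> (\<Inter>n\<in>{l..}. zeros (prefix_code x ` {l..<n})) \<noteq> {}"
  proof (rule compact_imp_fip_image)
    show "compact T" by (rule compact_cantor[OF closed])
    show "closed (zeros (prefix_code x ` {l..<n}))" for n by (rule closed_zeros)
    fix I' assume I': "finite I'" "I' \<subseteq> {l..}"
    obtain k where k: "\<forall>n\<in>I'. n \<le> k" using I'(1) finite_nat_set_iff_bounded_le by blast
    define n where "n = max k l"
    have "cond_measure T (prefix_code x ` {l..<n}) > 0"
      using ge[of n] threshold_pos(1)[of n] unfolding n_def by simp
    then have "T \<inter> zeros (prefix_code x ` {l..<n}) \<noteq> {}"
      unfolding cond_measure_def by force
    moreover have "zeros (prefix_code x ` {l..<n}) \<subseteq> (\<Inter>n\<in>I'. zeros (prefix_code x ` {l..<n}))"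
      using k unfolding zeros_def n_def by fastforce
    ultimately show "T \<inter> (\<Inter>n\<in>I'. zeros (prefix_code x ` {l..<n})) \<noteq> {}" by blast
  qed
  then obtain y where y: "y \<in> T" "\<And>n. n \<ge> l \<Longrightarrow> y \<in> zeros (prefix_code x ` {l..<n})" by blast
  have "{i \<in> range (prefix_code x). y i} \<subseteq> prefix_code x ` {..<l}"
  proof
    fix i assume "i \<in> {i \<in> range (prefix_code x). y i}"
    then obtain j where j: "i = prefix_code x j" "y i" by blast
    have "\<not> j \<ge> l"
    proof
      assume "j \<ge> l"
      then have "prefix_code x j \<in> prefix_code x ` {l..<Suc j}" by simp
      then show False using y(2)[of "Suc j"] \<open>j \<ge> l\<close> j unfolding zeros_def by auto
    qed
    then show "i \<in> prefix_code x ` {..<l}" using j(1) by auto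
  qed
  then have "finite {i \<in> range (prefix_code x). y i}" by (rule finite_subset) simp
  then have "y \<in> almost_zeros (range (prefix_code x))" by (simp only: almost_zeros_def mem_Collect_eq)
  then show False using assms y(1) by blast
qed

definition slalom :: "nat \<Rightarrow> bool list set" where
  "slalom n = {map x [0..<c (Suc n)] | x l. l \<le> n \<and> drops x l n}"

lemma card_slalom: "finite (slalom n) \<and> card (slalom n) \<le> 2 ^ c n * (n + 1) * width n"
proof -
  define P where "P l s = {map x [0..<c (Suc n)] | x. map x [0..<c n] = s \<and> drops x l n}" for l s
  have fl: "finite {s :: bool list. length s = k}" "card {s :: bool list. length s = k} = 2 ^ k" for k
    using finite_lists_length_eq[of "UNIV :: bool set" k] card_lists_length_eq[of "UNIV :: bool set" k]
    by simp_all
  have finP: "finite (P l s)" for l s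
    by (rule finite_subset[OF _ fl(1)[of "c (Suc n)"]]) (auto simp: P_def)
  have cardP: "card (P l s) \<le> width n" for l s
  proof (cases "P l s = {}")
    case False
    then obtain x0 where x0: "map x0 [0..<c n] = s" by (auto simp: P_def)
    define S where "S = prefix_code x0 ` {l..<n}"
    have same: "prefix_code x ` {l..<n} = S" if "map x [0..<c n] = s" for x
      unfolding S_def
    proof (intro image_cong refl)
      fix j assume "j \<in> {l..<n}"
      then have "c (Suc j) \<le> c n" using c by (simp add: strict_mono_less_eq)
      moreover have "x i = x0 i" if "i < c n" for i
        using that x0 \<open>map x [0..<c n] = s\<close> by (metis map_eq_conv atLeast0LessThan lessThan_iff set_upt)
      ultimately show "prefix_code x j = prefix_code x0 j" by (auto simp: prefix_code_def)
    qed
    have elem: "to_nat p \<notin> S \<and> cond_measure T (insert (to_nat p) S) \<le> cond_measure T S - (threshold n - threshold (Suc n))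
        \<or> l > n" if pP: "p \<in> P l s" for p
    proof (cases "l > n")
      case False
      obtain x where x: "p = map x [0..<c (Suc n)]" "map x [0..<c n] = s" "drops x l n"
        using pP by (auto simp: P_def)
      have p: "to_nat p = prefix_code x n" by (simp add: x(1) prefix_code_def)
      have "prefix_code x n \<notin> S"
        using prefix_code_eqD unfolding S_def by fastforce
      moreover have "{l..<Suc n} = insert n {l..<n}" using False by auto
      then have "prefix_code x ` {l..<Suc n} = insert (prefix_code x n) S"
        using same[OF x(2)] by simp
      then have "cond_measure T (insert (prefix_code x n) S) < threshold (Suc n)"
        "cond_measure T S \<ge> threshold n"
        using x(3) same[OF x(2)] unfolding drops_def by simp_all
      ultimately show ?thesis unfolding p by auto
    qed simp
    show ?thesis
    proof (cases "l \<le> n")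
      case True
      have "real (card (to_nat ` P l s)) \<le> 1 / (threshold n - threshold (Suc n))\<^sup>2"
      proof (rule few_influential_coordinates[OF closed])
        show "finite S" by (simp add: S_def)
        show "finite (to_nat ` P l s)" using finP by (rule finite_imageI)
        show "to_nat ` P l s \<inter> S = {}" using elem True by fastforce
        show "threshold n - threshold (Suc n) > 0" by (rule threshold_pos)
        show "cond_measure T (insert i S) \<le> cond_measure T S - (threshold n - threshold (Suc n))"
          if "i \<in> to_nat ` P l s" for i
          using elem True that by fastforce
      qed
      then have "card (to_nat ` P l s) \<le> width n" unfolding width_eq by simp
      then show ?thesis by (simp add: card_image)
    next
      case False
      have "\<not> drops x l n" for x
        using False threshold_pos(2)[of n] unfolding drops_def by simp
      then show ?thesis by (simp add: P_def)
    qed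
  qed simp
  have sub: "slalom n \<subseteq> (\<Union>l\<in>{..n}. \<Union>s\<in>{s. length s = c n}. P l s)"
  proof
    fix p assume "p \<in> slalom n"
    then obtain x l where x: "p = map x [0..<c (Suc n)]" "l \<le> n" "drops x l n" by (auto simp: slalom_def)
    then have "p \<in> P l (map x [0..<c n])" by (auto simp: P_def)
    moreover have "length (map x [0..<c n]) = c n" by simp
    ultimately show "p \<in> (\<Union>l\<in>{..n}. \<Union>s\<in>{s. length s = c n}. P l s)" using x(2) by blast
  qed
  have fin: "finite (\<Union>l\<in>{..n}. \<Union>s\<in>{s. length s = c n}. P l s)"
    using fl(1) finP by (intro finite_UN_I) auto
  have "card (\<Union>l\<in>{..n}. \<Union>s\<in>{s. length s = c n}. P l s) \<le> (\<Sum>l\<in>{..n}. card (\<Union>s\<in>{s. length s = c n}. P l s))"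
    by (rule card_UN_le) simp
  also have "\<dots> \<le> (\<Sum>l\<in>{..n}. 2 ^ c n * width n)"
  proof (rule sum_mono)
    fix l
    have "card (\<Union>s\<in>{s. length s = c n}. P l s) \<le> (\<Sum>s\<in>{s. length s = c n}. card (P l s))"
      by (rule card_UN_le[OF fl(1)])
    also have "\<dots> \<le> (\<Sum>s\<in>{s :: bool list. length s = c n}. width n)" using cardP by (rule sum_mono)
    also have "\<dots> = 2 ^ c n * width n" by (simp add: fl(2))
    finally show "card (\<Union>s\<in>{s. length s = c n}. P l s) \<le> 2 ^ c n * width n" .
  qed
  also have "\<dots> = 2 ^ c n * (n + 1) * width n" by (simp add: algebra_simps)
  finally have "card (\<Union>l\<in>{..n}. \<Union>s\<in>{s. length s = c n}. P l s) \<le> 2 ^ c n * (n + 1) * width n" .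
  then show ?thesis using finite_subset[OF sub fin] card_mono[OF fin sub] by linarith
qed

end

subsection \<open>The upper bound for NULL\<close>

primrec group_start :: "(nat \<Rightarrow> nat) \<Rightarrow> nat \<Rightarrow> nat" where
  "group_start b 0 = 0"
| "group_start b (Suc n) = group_start b n + 2 ^ b (group_start b n) * (n + 1) * width n"

lemma strict_mono_group_start: "strict_mono (group_start b)"
  by (simp add: strict_mono_Suc_iff width_def)

text \<open>The \<open>n\<close>-th group of blocks has as many blocks as the \<open>n\<close>-th set of the slalom has members,
  and \<open>x\<close> agrees on the \<open>i\<close>-th block of the group with the \<open>i\<close>-th member.\<close>

lemma infinitely_often_equal:
  fixes X :: "'a \<Rightarrow> cantor"
  assumes b: "strict_mono b"
    and null: "\<And>H. \<forall>A\<in>\<A>. infinite (H A) \<Longrightarrow>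
      (\<Union>A\<in>\<A>. almost_zeros (H A)) \<in> sigma_closed_null_sets"
  shows "\<exists>x. \<forall>A\<in>\<A>. \<forall>M. \<exists>m\<ge>M. \<forall>i. b m \<le> i \<and> i < b (Suc m) \<longrightarrow> x i = X A i"
proof -
  define e where "e = group_start b"
  have e: "strict_mono e" unfolding e_def by (rule strict_mono_group_start)
  define c where "c n = b (e n)" for n
  have "strict_mono c" unfolding c_def using strict_mono_compose[OF b e] .
  then interpret prefix_coding c by unfold_locales
  have "(\<Union>A\<in>\<A>. almost_zeros (range (prefix_code (X A)))) \<in> sigma_closed_null_sets"
    by (intro null ballI infinite_prefix_codes)
  from positive_avoiding_set[OF this] obtain T where
    T: "closed T" "T \<inter> (\<Union>A\<in>\<A>. almost_zeros (range (prefix_code (X A)))) = {}"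
      "measure cantor_measure T \<ge> 1 / 2" by blast
  interpret prefix_slalom c T by unfold_locales (use T in auto)
  have "\<forall>n. \<exists>h. bij_betw h {..<card (slalom n)} (slalom n)"
    using card_slalom ex_bij_betw_nat_finite unfolding atLeast0LessThan by blast
  then obtain h where h: "\<forall>n. bij_betw (h n) {..<card (slalom n)} (slalom n)"
    by (auto simp only: choice_iff)
  define blk where "blk i = (LEAST m. i < b (Suc m))" for i
  define grp where "grp m = (LEAST n. m < e (Suc n))" for m
  define x where "x i = h (grp (blk i)) (blk i - e (grp (blk i))) ! i" for i
  have "\<exists>m\<ge>M. \<forall>i. b m \<le> i \<and> i < b (Suc m) \<longrightarrow> x i = X A i" if A: "A \<in> \<A>" for A M
  proof -
    have "T \<inter> almost_zeros (range (prefix_code (X A))) = {}" using T(2) A by blast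
    from ex_drops[OF this, of M] obtain n where n: "n \<ge> M" "drops (X A) M n" by blast
    have "map (X A) [0..<c (Suc n)] \<in> slalom n" using n unfolding slalom_def by blast
    then obtain j where j: "j < card (slalom n)" "h n j = map (X A) [0..<c (Suc n)]"
      using h[rule_format, of n] unfolding bij_betw_def by (metis imageE lessThan_iff)
    define m where "m = e n + j"
    have "j < 2 ^ c n * (n + 1) * width n" using j(1) card_slalom[of n] by linarith
    then have m: "e n \<le> m" "m < e (Suc n)" by (simp_all add: m_def e_def c_def)
    have grp: "grp m = n" unfolding grp_def by (rule block_index[OF e m])
    have "x i = X A i" if i: "b m \<le> i" "i < b (Suc m)" for i
    proof -
      have "blk i = m" unfolding blk_def by (rule block_index[OF b i])
      then have "x i = map (X A) [0..<c (Suc n)] ! i" using grp j(2) by (simp add: x_def m_def)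
      moreover have "b (Suc m) \<le> c (Suc n)" using m(2) b by (simp add: c_def strict_mono_less_eq)
      then have "i < c (Suc n)" using i(2) by simp
      ultimately show ?thesis by simp
    qed
    moreover have "M \<le> m" using n(1) m(1) strict_mono_imp_increasing[OF e, of n] by simp
    ultimately show ?thesis by blast
  qed
  then show ?thesis by blast
qed

lemma ex_strict_mono_step:
  assumes "\<And>l :: nat. l < f l"
  shows "\<exists>b. strict_mono b \<and> (\<forall>n. b (Suc n) = f (b n))"
proof -
  have "strict_mono (\<lambda>n. (f ^^ n) 0)" using assms by (simp add: strict_mono_Suc_iff)
  then show ?thesis by (intro exI[of _ "\<lambda>n. (f ^^ n) 0"]) simp
qed

lemma meager_Union_if_null:
  assumes null: "\<And>H. \<forall>A\<in>\<A>. infinite (H A) \<Longrightarrow>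
      (\<Union>A\<in>\<A>. almost_zeros (H A)) \<in> sigma_closed_null_sets"
    and meager: "\<A> \<subseteq> meager_sets"
  shows "\<Union>\<A> \<in> meager_sets"
proof -
  have gap: "\<exists>B. (\<forall>l. l < B l) \<and> (\<forall>A\<in>\<A>. \<exists>N. \<forall>l\<ge>N. \<exists>i\<in>H A. l \<le> i \<and> i < B l)"
    if inf: "\<forall>A\<in>\<A>. infinite (H A)" for H :: "cantor set \<Rightarrow> nat set"
  proof -
    obtain B where B: "\<forall>A\<in>\<A>. \<exists>N. \<forall>l\<ge>N. \<exists>i\<in>H A. l \<le> i \<and> i < B l"
      using gap_bound[OF null[OF inf]] by blast
    have "\<forall>A\<in>\<A>. \<exists>N. \<forall>l\<ge>N. \<exists>i\<in>H A. l \<le> i \<and> i < max (B l) (Suc l)"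
      using B by (simp add: less_max_iff_disj) blast
    then show ?thesis by (intro exI[of _ "\<lambda>l. max (B l) (Suc l)"]) (simp add: less_max_iff_disj)
  qed
  have "\<forall>A\<in>\<A>. \<exists>p. strict_mono (snd p) \<and> A \<subseteq> blockset (fst p) (snd p)"
    using meager_blockset meager by fastforce
  then obtain p where p: "\<forall>A\<in>\<A>. strict_mono (snd (p A)) \<and> A \<subseteq> blockset (fst (p A)) (snd (p A))"
    by (auto simp only: bchoice_iff)
  define X where "X A = fst (p A)" for A
  define a where "a A = snd (p A)" for A
  have a: "strict_mono (a A)" if "A \<in> \<A>" for A using p that by (simp add: a_def)
  have sub: "A \<subseteq> blockset (X A) (a A)" if "A \<in> \<A>" for A using p that by (simp add: a_def X_def)
  have "\<forall>A\<in>\<A>. infinite (range (a A))"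
    using strict_mono_imp_inj_on[OF a] range_inj_infinite by blast
  from gap[OF this] obtain B where B: "\<forall>l. l < B l"
    "\<forall>A\<in>\<A>. \<exists>N. \<forall>l\<ge>N. \<exists>i\<in>range (a A). l \<le> i \<and> i < B l" by blast
  have "l < B (B l)" for l using B(1) less_trans by blast
  then obtain b where b: "strict_mono b" "\<forall>n. b (Suc n) = B (B (b n))"
    using ex_strict_mono_step[of "\<lambda>l. B (B l)"] by blast
  have blocks: "\<exists>M. \<forall>m\<ge>M. \<exists>k. b m \<le> a A k \<and> a A (Suc k) \<le> b (Suc m)" if A: "A \<in> \<A>" for A
  proof -
    obtain N where N: "\<And>l. l \<ge> N \<Longrightarrow> \<exists>i\<in>range (a A). l \<le> i \<and> i < B l" using B(2) A by blast
    have "\<exists>k. b m \<le> a A k \<and> a A (Suc k) \<le> b (Suc m)" if m: "m \<ge> N" for m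
    proof -
      have bm: "N \<le> b m" using m strict_mono_imp_increasing[OF b(1), of m] by simp
      obtain k where k: "b m \<le> a A k" "a A k < B (b m)" using N[OF bm] by blast
      have "N \<le> B (b m)" using bm B(1) less_imp_le le_trans by blast
      then obtain j where j: "B (b m) \<le> a A j" "a A j < B (B (b m))" using N[of "B (b m)"] by blast
      have "a A k < a A j" using k j by simp
      then have "Suc k \<le> j" using a[OF A] by (simp add: strict_mono_less)
      then have "a A (Suc k) \<le> a A j" using a[OF A] by (simp add: strict_mono_less_eq)
      then show ?thesis using k(1) j(2) b(2) by (intro exI[of _ k]) simp
    qed
    then show ?thesis by blast
  qed
  obtain x where x: "\<forall>A\<in>\<A>. \<forall>M. \<exists>m\<ge>M. \<forall>i. b m \<le> i \<and> i < b (Suc m) \<longrightarrow> x i = X A i"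
    using infinitely_often_equal[OF b(1) null, of X] by blast
  define H where "H A = b ` {m. \<forall>i. b m \<le> i \<and> i < b (Suc m) \<longrightarrow> x i = X A i}" for A
  have "\<forall>A\<in>\<A>. infinite (H A)"
  proof
    fix A assume A: "A \<in> \<A>"
    have "infinite {m. \<forall>i. b m \<le> i \<and> i < b (Suc m) \<longrightarrow> x i = X A i}"
      unfolding infinite_nat_iff_unbounded_le using x A by blast
    then show "infinite (H A)"
      unfolding H_def using finite_imageD[OF _ strict_mono_imp_inj_on[OF b(1), THEN inj_on_subset]] by blast
  qed
  from gap[OF this] obtain B' where B': "\<forall>l. l < B' l"
    "\<forall>A\<in>\<A>. \<exists>N. \<forall>l\<ge>N. \<exists>i\<in>H A. l \<le> i \<and> i < B' l" by blast
  have "l < b (B' l)" for l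
    using B'(1) strict_mono_imp_increasing[OF b(1), of "B' l"] by (meson less_le_trans)
  then obtain d where d: "strict_mono d" "\<forall>n. d (Suc n) = b (B' (d n))"
    using ex_strict_mono_step[of "\<lambda>l. b (B' l)"] by blast
  have "captures x d (X A) (a A)" if A: "A \<in> \<A>" for A
  proof -
    obtain N where N: "\<And>l. l \<ge> N \<Longrightarrow> \<exists>i\<in>H A. l \<le> i \<and> i < B' l" using B'(2) A by blast
    obtain M where M: "\<And>m. m \<ge> M \<Longrightarrow> \<exists>k. b m \<le> a A k \<and> a A (Suc k) \<le> b (Suc m)"
      using blocks[OF A] by blast
    have "\<exists>k. d n \<le> a A k \<and> a A (Suc k) \<le> d (Suc n) \<and> (\<forall>i. a A k \<le> i \<and> i < a A (Suc k) \<longrightarrow> x i = X A i)"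
      if n: "n \<ge> max N (b M)" for n
    proof -
      have dn: "n \<le> d n" by (rule strict_mono_imp_increasing[OF d(1)])
      then have "N \<le> d n" using n by simp
      then obtain m where m: "d n \<le> b m" "b m < B' (d n)" "\<And>i. b m \<le> i \<Longrightarrow> i < b (Suc m) \<Longrightarrow> x i = X A i"
        using N[of "d n"] unfolding H_def by blast
      have "b M \<le> b m" using n dn m(1) by simp
      then have "M \<le> m" using b(1) by (simp add: strict_mono_less_eq)
      then obtain k where k: "b m \<le> a A k" "a A (Suc k) \<le> b (Suc m)" using M by blast
      have "Suc m \<le> B' (d n)"
        using m(2) strict_mono_imp_increasing[OF b(1), of m] by simp
      then have "b (Suc m) \<le> d (Suc n)" using b(1) d(2) by (simp add: strict_mono_less_eq)
      then show ?thesis using k m by (intro exI[of _ k]) auto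
    qed
    then show ?thesis unfolding captures_def by blast
  qed
  then have "blockset (X A) (a A) \<subseteq> blockset x d" if "A \<in> \<A>" for A
    using blockset_mono[OF _ a[OF that] d(1)] that by blast
  then have "\<Union>\<A> \<subseteq> blockset x d" using sub by blast
  then show ?thesis by (rule meager_subset[OF blockset_meager[OF d(1)]])
qed

lemma b_NULL_le_add:
  assumes D: "countable D" "closure D = UNIV"
  shows "b_ideal D (NULL D) \<le>o add_ideal meager_sets"
proof -
  obtain \<A> where A: "\<A> \<subseteq> meager_sets" "\<Union>\<A> \<notin> meager_sets" "add_ideal meager_sets = |\<A>|"
    using add_meager_attained by blast
  have "b_ideal D (NULL D) \<le>o |\<A>|"
  proof (rule ccontr)
    assume small: "\<not> ?thesis"
    have "\<Union>\<A> \<in> meager_sets"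
    proof (rule meager_Union_if_null[OF _ A(1)])
      show "(\<Union>A\<in>\<A>. almost_zeros (H A)) \<in> sigma_closed_null_sets" if "\<forall>A\<in>\<A>. infinite (H A)" for H
        by (rule almost_zeros_UN_sigma_closed_null[OF D small]) (use that in blast)
    qed
    then show False using A(2) by blast
  qed
  then show ?thesis using A(3) by simp
qed

theorem corollary3p7:
  fixes D :: "cantor set"
  assumes "countable D" and "closure D = UNIV"
  shows "b_ideal D (NWD D) =o add_ideal meager_sets
    \<and> (pseudointersection_number \<le>o b_ideal D (NULL D)
       \<and> b_ideal D (NULL D) \<le>o add_ideal meager_sets)
    \<and> b_ideal D (CTBL D) =o cardSuc natLeq"
proof (intro conjI)
  have "UNIV \<notin> sigma_closed_null_sets" using null.no_cyl by blast
  from null.ex_unbounded_below_le_card[OF assms this]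
  obtain F0 where "unbounded_below D (NULL D) F0" unfolding NULL_def by blast
  then obtain F where F: "unbounded_below D (NULL D) F" "b_ideal D (NULL D) = |F|"
    using b_ideal_attained by blast
  show "pseudointersection_number \<le>o b_ideal D (NULL D)"
    unfolding F(2) by (rule p_le_unbounded_below_NULL[OF assms(1) F(1)])
qed (rule b_NWD[OF assms] b_NULL_le_add[OF assms] b_CTBL[OF assms])+

end
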